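(* Let $\mathcal{M}$ be an $n$-dimensional smooth complete Riemannian manifold, let $f\colon\mathcal{M}\to\mathbb{R}$, $h=(h_1,\dots,h_s)\colon\mathcal{M}\to\mathbb{R}^s$ and $g=(g_1,\dots,g_m)\colon\mathcal{M}\to\mathbb{R}^m$ be continuously differentiable, and let $\Omega=\{q\in\mathcal{M}: h(q)=0,\ g(q)\le 0\}$. Let $(p^k)_{k\in\mathbb{N}}$ be a sequence generated by the safeguarded augmented Lagrangian algorithm applied to the problem of minimizing $f$ over $\Omega$, and let $p$ be a limit point (accumulation point) of $(p^k)_{k\in\mathbb{N}}$ with $p\in\Omega$. If $p$ satisfies RCPLD or CRSC, then $p$ satisfies the KKT conditions.
   Context: $d$ is the Riemannian distance, $B_\epsilon(p)=\{q\in\mathcal{M}: d(p,q)<\epsilon\}$, $\operatorname{grad}$ is the Riemannian gradient (with respect to the variable in $\mathcal{M}$), and $[y]_+$ is the componentwise positive part. For $p\in\Omega$, $\mathcal{A}(p)=\{j: g_j(p)=0\}$. KKT conditions at $p\in\Omega$: there is $(\lambda,\mu)\in\mathbb{R}^s\times\mathbb{R}^m_+$ with $\operatorname{grad}f(p)+\sum_i\lambda_i\operatorname{grad}h_i(p)+\sum_j\mu_j\operatorname{grad}g_j(p)=0$ and $\mu_j=0$ for all $j\notin\mathcal{A}(p)$. Augmented Lagrangian: $\mathcal{L}_\rho(q,\lambda,\mu)=f(q)+\frac{\rho}{2}\left(\left\|h(q)+\frac{\lambda}{\rho}\right\|^2+\left\|\left[g(q)+\frac{\mu}{\rho}\right]_+\right\|^2\right)$.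 Safeguarded augmented Lagrangian algorithm. Step 0: take $p^0\in\mathcal{M}$, $\tau\in[0,1)$, $\gamma>1$, $\lambda_{\min}<\lambda_{\max}$, $\mu_{\max}>0$, $\rho_1>0$, $\bar\lambda^1\in[\lambda_{\min},\lambda_{\max}]^s$, $\bar\mu^1\in[0,\mu_{\max}]^m$, and $(\epsilon_k)\subset\mathbb{R}_+$ with $\epsilon_k\to0$; set $k=1$. Step 1: compute (if possible; otherwise stop declaring failure) $p^k$ with $\|\operatorname{grad}\mathcal{L}_{\rho_k}(p^k,\bar\lambda^k,\bar\mu^k)\|\le\epsilon_k$. Step 2: set $\lambda^k=\bar\lambda^k+\rho_kh(p^k)$ and $\mu^k=[\bar\mu^k+\rho_kg(p^k)]_+$. Step 3: set $V^k=(\mu^k-\bar\mu^k)/\rho_k$; if $k=1$ or $\max\{\|h(p^k)\|_2,\|V^k\|_2\}\le\tau\max\{\|h(p^{k-1})\|_2,\|V^{k-1}\|_2\}$, set $\rho_{k+1}=\rho_k$; otherwise $\rho_{k+1}=\gamma\rho_k$. Step 4: choose any $\bar\lambda^{k+1}\in[\lambda_{\min},\lambda_{\max}]^s$ and $\bar\mu^{k+1}\in[0,\mu_{\max}]^m$. Step 5: replace $k$ by $k+1$ and go to Step 1. The sequence $(p^k)_{k\in\mathbb{N}}$ is an infinite sequence so produced (no failure in Step 1). Families of gradients are regarded as multisets. A pair of finite families $(\{v_i\}_{i\in I},\{w_j\}_{j\in J})$ in $T_p\mathcal{M}$, also written as the union, is positive-linearly dependent if there are $\alpha_i\in\mathbb{R}$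 and $\beta_j\ge0$, not all zero, with $\sum_i\alpha_iv_i+\sum_j\beta_jw_j=0$; gradients of $h_i$ play the role of the $v_i$ and gradients of $g_j$ the role of the $w_j$. RCPLD at $p$: there is $\epsilon>0$ such that (a) the rank of $\{\operatorname{grad}h_i(q): i=1,\dots,s\}$ is constant for $q\in B_\epsilon(p)$; and (b) with $\mathcal{K}\subset\{1,\dots,s\}$ such that $\{\operatorname{grad}h_i(p): i\in\mathcal{K}\}$ is a basis of the subspace generated by $\{\operatorname{grad}h_i(p): i=1,\dots,s\}$ (the condition does not depend on the choice of $\mathcal{K}$), for all $\mathcal{J}\subset\mathcal{A}(p)$, if $\{\operatorname{grad}h_i(p): i\in\mathcal{K}\}\cup\{\operatorname{grad}g_j(p): j\in\mathcal{J}\}$ is positive-linearly dependent, then $\{\operatorname{grad}h_i(q): i\in\mathcal{K}\}\cup\{\operatorname{grad}g_j(q): j\in\mathcal{J}\}$ is linearly dependent for all $q\in B_\epsilon(p)$. CRSC at $p$: let $\mathcal{L}(p)^\circ=\{\sum_{i=1}^s\lambda_i\operatorname{grad}h_i(p)+\sum_{j\in\mathcal{A}(p)}\mu_j\operatorname{grad}g_j(p): \lambda_i\in\mathbb{R},\ \mu_j\ge0\}$ and $\mathcal{J}_-(p)=\{j\in\mathcal{A}(p): -\operatorname{grad}g_j(p)\in\mathcal{L}(p)^\circ\}$; CRSC holds if there is $\epsilon>0$ such that the rank of $\{\operatorname{grad}h_i(q): i=1,\dots,s\}\cup\{\operatorname{grad}g_j(q): j\in\mathcal{J}_-(p)\}$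 is constant for $q\in B_\epsilon(p)$. *)

theory Defs
  imports "HOL-Analysis.Analysis" "HOL-Library.Function_Algebras"
begin

section \<open>Functions into a real vector space\<close>

text \<open>
  Tangent vectors are represented below by functions into the model space, with the pointwise
  vector space operations; the additive part comes from \<^theory>\<open>HOL-Library.Function_Algebras\<close>.
\<close>

instantiation "fun" :: (type, real_vector) real_vector
begin

definition scaleR_fun :: "real \<Rightarrow> ('a \<Rightarrow> 'b) \<Rightarrow> 'a \<Rightarrow> 'b" where
  "scaleR_fun r f = (\<lambda>x. r *\<^sub>R f x)"

instance
  by standard (simp_all add: scaleR_fun_def fun_eq_iff scaleR_add_right scaleR_add_left)

end


section \<open>Smooth manifolds\<close>

text \<open>For open sets in finite-dimensional spaces this is the usual notion of class \<open>C\<^sup>k\<close>.\<close>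

primrec Ck_on :: "nat \<Rightarrow> ('a::euclidean_space \<Rightarrow> 'b::real_normed_vector) \<Rightarrow> 'a set \<Rightarrow> bool" where
  "Ck_on 0 F S \<longleftrightarrow> continuous_on S F"
| "Ck_on (Suc k) F S \<longleftrightarrow>
     (\<forall>x\<in>S. F differentiable (at x)) \<and> (\<forall>v. Ck_on k (\<lambda>x. frechet_derivative F (at x) v) S)"

definition smooth_on :: "('a::euclidean_space \<Rightarrow> 'b::real_normed_vector) \<Rightarrow> 'a set \<Rightarrow> bool" where
  "smooth_on F S \<longleftrightarrow> (\<forall>k. Ck_on k F S)"

text \<open>
  A chart is a pair \<open>(U, x)\<close> of its domain and its coordinate map; the values of \<open>x\<close> outside \<open>U\<close>
  are irrelevant. The manifold is the whole type \<open>'a\<close>, and its dimension is \<open>DIM('e)\<close>.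
\<close>

type_synonym ('a, 'e) chart = "'a set \<times> ('a \<Rightarrow> 'e)"

abbreviation (input) cdom :: "('a, 'e) chart \<Rightarrow> 'a set" where "cdom \<equiv> fst"
abbreviation (input) coord :: "('a, 'e) chart \<Rightarrow> 'a \<Rightarrow> 'e" where "coord \<equiv> snd"

definition param :: "('a, 'e) chart \<Rightarrow> 'e \<Rightarrow> 'a" where
  "param \<phi> = inv_into (cdom \<phi>) (coord \<phi>)"

definition is_chart :: "('a::topological_space, 'e::euclidean_space) chart \<Rightarrow> bool" where
  "is_chart \<phi> \<longleftrightarrow> open (cdom \<phi>) \<and> open (coord \<phi> ` cdom \<phi>) \<and>
     homeomorphism (cdom \<phi>) (coord \<phi> ` cdom \<phi>) (coord \<phi>) (param \<phi>)"

definition smooth_atlas ::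
  "('a::{second_countable_topology, t2_space}, 'e::euclidean_space) chart set \<Rightarrow> bool" where
  "smooth_atlas A \<longleftrightarrow>
     (\<forall>\<phi>\<in>A. is_chart \<phi>) \<and> \<Union> (cdom ` A) = UNIV \<and>
     (\<forall>\<phi>\<in>A. \<forall>\<psi>\<in>A. smooth_on (coord \<psi> \<circ> param \<phi>) (coord \<phi> ` (cdom \<phi> \<inter> cdom \<psi>)))"

definition charts_at :: "('a, 'e) chart set \<Rightarrow> 'a \<Rightarrow> ('a, 'e) chart set" where
  "charts_at A p = {\<phi> \<in> A. p \<in> cdom \<phi>}"

definition C1_map ::
  "('a, 'e::euclidean_space) chart set \<Rightarrow> ('a \<Rightarrow> 'b::real_normed_vector) \<Rightarrow> bool" where
  "C1_map A F \<longleftrightarrow> (\<forall>\<phi>\<in>A. Ck_on 1 (F \<circ> param \<phi>) (coord \<phi> ` cdom \<phi>))"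


section \<open>Tangent vectors\<close>

text \<open>
  A tangent vector at \<open>p\<close> assigns to each chart around \<open>p\<close> its coordinate vector in that chart,
  subject to the transformation rule under change of charts. To make the representation unique,
  it is zero on everything that is not a chart around \<open>p\<close>.
\<close>

type_synonym ('a, 'e) tvec = "('a, 'e) chart \<Rightarrow> 'e"

definition tangent_space ::
  "('a, 'e::euclidean_space) chart set \<Rightarrow> 'a \<Rightarrow> ('a, 'e) tvec set" where
  "tangent_space A p = {v.
     (\<forall>\<phi>. \<phi> \<notin> charts_at A p \<longrightarrow> v \<phi> = 0) \<and>
     (\<forall>\<phi> \<in> charts_at A p. \<forall>\<psi> \<in> charts_at A p.
        v \<psi> = frechet_derivative (coord \<psi> \<circ> param \<phi>) (at (coord \<phi> p)) (v \<phi>))}"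

text \<open>The tangent vector at \<open>p\<close> whose coordinate vector in the chart \<open>\<phi>\<close> is \<open>x\<close>.\<close>

definition coord_vec ::
  "('a, 'e::euclidean_space) chart set \<Rightarrow> ('a, 'e) chart \<Rightarrow> 'a \<Rightarrow> 'e \<Rightarrow> ('a, 'e) tvec" where
  "coord_vec A \<phi> p x = (\<lambda>\<psi>. if \<psi> \<in> charts_at A p
     then frechet_derivative (coord \<psi> \<circ> param \<phi>) (at (coord \<phi> p)) x else 0)"

text \<open>For differentiable \<open>F\<close>, the value does not depend on the choice of the chart around \<open>p\<close>.\<close>

definition differential ::
  "('a, 'e::euclidean_space) chart set \<Rightarrow> ('a \<Rightarrow> real) \<Rightarrow> 'a \<Rightarrow> ('a, 'e) tvec \<Rightarrow> real" where
  "differential A F p v = (let \<phi> = (SOME \<phi>. \<phi> \<in> charts_at A p)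
     in frechet_derivative (F \<circ> param \<phi>) (at (coord \<phi> p)) (v \<phi>))"


section \<open>Riemannian manifolds\<close>

type_synonym ('a, 'e) metric = "'a \<Rightarrow> ('a, 'e) tvec \<Rightarrow> ('a, 'e) tvec \<Rightarrow> real"

definition riemannian_metric ::
  "('a, 'e::euclidean_space) chart set \<Rightarrow> ('a, 'e) metric \<Rightarrow> bool" where
  "riemannian_metric A G \<longleftrightarrow>
     (\<forall>p. \<forall>u \<in> tangent_space A p. \<forall>v \<in> tangent_space A p.
        G p u v = G p v u \<and>
        (\<forall>w \<in> tangent_space A p. G p (u + v) w = G p u w + G p v w) \<and>
        (\<forall>c. G p (c *\<^sub>R u) v = c * G p u v) \<and>
        (u \<noteq> 0 \<longrightarrow> G p u u > 0)) \<and>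
     (\<forall>\<phi>\<in>A. \<forall>x y. smooth_on
        (\<lambda>z. G (param \<phi> z) (coord_vec A \<phi> (param \<phi> z) x) (coord_vec A \<phi> (param \<phi> z) y))
        (coord \<phi> ` cdom \<phi>))"

definition tnorm :: "('a, 'e) metric \<Rightarrow> 'a \<Rightarrow> ('a, 'e) tvec \<Rightarrow> real" where
  "tnorm G p v = sqrt (G p v v)"

definition grad ::
  "('a, 'e::euclidean_space) chart set \<Rightarrow> ('a, 'e) metric \<Rightarrow> ('a \<Rightarrow> real) \<Rightarrow> 'a \<Rightarrow> ('a, 'e) tvec" where
  "grad A G F p = (THE v. v \<in> tangent_space A p \<and>
     (\<forall>w \<in> tangent_space A p. G p v w = differential A F p w))"

text \<open>
  \<open>C\<^sup>1\<close> on the closed interval, with one-sided derivatives at its endpoints; the set of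
  parameters mapped into a chart domain is relatively open in \<open>{a..b}\<close>.
\<close>

definition C1_curve_on ::
  "('a::topological_space, 'e::euclidean_space) chart set \<Rightarrow> real \<Rightarrow> real \<Rightarrow> (real \<Rightarrow> 'a) \<Rightarrow> bool" where
  "C1_curve_on A a b c \<longleftrightarrow> continuous_on {a..b} c \<and>
     (\<forall>\<phi>\<in>A. \<exists>D. continuous_on {t \<in> {a..b}. c t \<in> cdom \<phi>} D \<and>
        (\<forall>t \<in> {a..b}. c t \<in> cdom \<phi> \<longrightarrow>
           ((coord \<phi> \<circ> c) has_vector_derivative D t) (at t within {a..b})))"

definition piecewise_C1_curve ::
  "('a::topological_space, 'e::euclidean_space) chart set \<Rightarrow> (real \<Rightarrow> 'a) \<Rightarrow> bool" where
  "piecewise_C1_curve A c \<longleftrightarrow> (\<exists>n (t :: nat \<Rightarrow> real). t 0 = 0 \<and> t n = 1 \<and>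
     (\<forall>i<n. t i < t (Suc i) \<and> C1_curve_on A (t i) (t (Suc i)) c))"

definition velocity ::
  "('a, 'e::euclidean_space) chart set \<Rightarrow> (real \<Rightarrow> 'a) \<Rightarrow> real \<Rightarrow> ('a, 'e) tvec" where
  "velocity A c t = (\<lambda>\<phi>. if \<phi> \<in> charts_at A (c t)
     then vector_derivative (coord \<phi> \<circ> c) (at t) else 0)"

text \<open>The integrand is not meaningful at the finitely many break points, which does not matter.\<close>

definition curve_length ::
  "('a, 'e::euclidean_space) chart set \<Rightarrow> ('a, 'e) metric \<Rightarrow> (real \<Rightarrow> 'a) \<Rightarrow> real" where
  "curve_length A G c = integral {0..1} (\<lambda>t. tnorm G (c t) (velocity A c t))"

text \<open>
  The distance is extended-real valued because the manifold is not assumed to be connected: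
  it is \<open>\<infinity>\<close> between points in different components.
\<close>

definition riem_dist ::
  "('a::topological_space, 'e::euclidean_space) chart set \<Rightarrow> ('a, 'e) metric \<Rightarrow> 'a \<Rightarrow> 'a \<Rightarrow> ereal" where
  "riem_dist A G p q =
     (INF c \<in> {c. piecewise_C1_curve A c \<and> c 0 = p \<and> c 1 = q}. ereal (curve_length A G c))"

definition riem_ball ::
  "('a::topological_space, 'e::euclidean_space) chart set \<Rightarrow> ('a, 'e) metric \<Rightarrow> 'a \<Rightarrow> real \<Rightarrow> 'a set" where
  "riem_ball A G p \<epsilon> = {q. riem_dist A G p q < ereal \<epsilon>}"

text \<open>Completeness of the Riemannian distance, equivalent to geodesic completeness by Hopf--Rinow.\<close>

definition riem_complete ::
  "('a::topological_space, 'e::euclidean_space) chart set \<Rightarrow> ('a, 'e) metric \<Rightarrow> bool" where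
  "riem_complete A G \<longleftrightarrow> (\<forall>u :: nat \<Rightarrow> 'a.
     (\<forall>\<epsilon>>0. \<exists>N. \<forall>i\<ge>N. \<forall>j\<ge>N. riem_dist A G (u i) (u j) < ereal \<epsilon>) \<longrightarrow>
     (\<exists>q. \<forall>\<epsilon>>0. \<exists>N. \<forall>i\<ge>N. riem_dist A G (u i) q < ereal \<epsilon>))"

definition complete_riemannian_manifold ::
  "('a::{second_countable_topology, t2_space}, 'e::euclidean_space) chart set \<Rightarrow> ('a, 'e) metric \<Rightarrow> bool"
  where
  "complete_riemannian_manifold A G \<longleftrightarrow>
     smooth_atlas A \<and> riemannian_metric A G \<and> riem_complete A G"


section \<open>The constrained problem\<close>

text \<open>
  Elements of \<open>\<real>\<^sup>s\<close> are functions on \<open>nat\<close> of which only the values on \<open>{1..s}\<close> are used, with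
  \<^const>\<open>L2_set\<close> as Euclidean norm. The cases \<open>s = 0\<close> and \<open>m = 0\<close> are included.
\<close>

definition feasible_set ::
  "nat \<Rightarrow> nat \<Rightarrow> (nat \<Rightarrow> 'a \<Rightarrow> real) \<Rightarrow> (nat \<Rightarrow> 'a \<Rightarrow> real) \<Rightarrow> 'a set" where
  "feasible_set s m h g = {q. (\<forall>i\<in>{1..s}. h i q = 0) \<and> (\<forall>j\<in>{1..m}. g j q \<le> 0)}"

definition active :: "nat \<Rightarrow> (nat \<Rightarrow> 'a \<Rightarrow> real) \<Rightarrow> 'a \<Rightarrow> nat set" where
  "active m g p = {j \<in> {1..m}. g j p = 0}"

definition KKT ::
  "('a, 'e::euclidean_space) chart set \<Rightarrow> ('a, 'e) metric \<Rightarrow> nat \<Rightarrow> nat \<Rightarrow> ('a \<Rightarrow> real) \<Rightarrow>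
   (nat \<Rightarrow> 'a \<Rightarrow> real) \<Rightarrow> (nat \<Rightarrow> 'a \<Rightarrow> real) \<Rightarrow> 'a \<Rightarrow> bool" where
  "KKT A G s m f h g p \<longleftrightarrow> (\<exists>lam mu :: nat \<Rightarrow> real.
     (\<forall>j\<in>{1..m}. mu j \<ge> 0) \<and>
     grad A G f p + (\<Sum>i=1..s. lam i *\<^sub>R grad A G (h i) p)
       + (\<Sum>j=1..m. mu j *\<^sub>R grad A G (g j) p) = 0 \<and>
     (\<forall>j \<in> {1..m} - active m g p. mu j = 0))"


section \<open>Constraint qualifications\<close>

text \<open>Indexed families, so that repeated vectors count with multiplicity.\<close>

definition pos_lin_dependent ::
  "'i set \<Rightarrow> ('i \<Rightarrow> 'v::real_vector) \<Rightarrow> 'j set \<Rightarrow> ('j \<Rightarrow> 'v) \<Rightarrow> bool" where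
  "pos_lin_dependent I v J w \<longleftrightarrow> (\<exists>\<alpha> \<beta>.
     (\<forall>j\<in>J. \<beta> j \<ge> 0) \<and> ((\<exists>i\<in>I. \<alpha> i \<noteq> 0) \<or> (\<exists>j\<in>J. \<beta> j \<noteq> 0)) \<and>
     (\<Sum>i\<in>I. \<alpha> i *\<^sub>R v i) + (\<Sum>j\<in>J. \<beta> j *\<^sub>R w j) = 0)"

definition lin_dependent ::
  "'i set \<Rightarrow> ('i \<Rightarrow> 'v::real_vector) \<Rightarrow> 'j set \<Rightarrow> ('j \<Rightarrow> 'v) \<Rightarrow> bool" where
  "lin_dependent I v J w \<longleftrightarrow> (\<exists>\<alpha> \<beta>.
     ((\<exists>i\<in>I. \<alpha> i \<noteq> 0) \<or> (\<exists>j\<in>J. \<beta> j \<noteq> 0)) \<and>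
     (\<Sum>i\<in>I. \<alpha> i *\<^sub>R v i) + (\<Sum>j\<in>J. \<beta> j *\<^sub>R w j) = 0)"

text \<open>The subfamily of \<open>v\<close> indexed by \<open>K\<close> is a basis of the span of the family indexed by \<open>I\<close>.\<close>

definition basis_indices :: "'i set \<Rightarrow> 'i set \<Rightarrow> ('i \<Rightarrow> 'v::real_vector) \<Rightarrow> bool" where
  "basis_indices K I v \<longleftrightarrow>
     K \<subseteq> I \<and> inj_on v K \<and> independent (v ` K) \<and> span (v ` K) = span (v ` I)"

definition RCPLD ::
  "('a::topological_space, 'e::euclidean_space) chart set \<Rightarrow> ('a, 'e) metric \<Rightarrow> nat \<Rightarrow> nat \<Rightarrow>
   (nat \<Rightarrow> 'a \<Rightarrow> real) \<Rightarrow> (nat \<Rightarrow> 'a \<Rightarrow> real) \<Rightarrow> 'a \<Rightarrow> bool" where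
  "RCPLD A G s m h g p \<longleftrightarrow> (\<exists>\<epsilon>>0.
     (\<exists>r. \<forall>q \<in> riem_ball A G p \<epsilon>. dim ((\<lambda>i. grad A G (h i) q) ` {1..s}) = r) \<and>
     (\<exists>K. basis_indices K {1..s} (\<lambda>i. grad A G (h i) p) \<and>
       (\<forall>J \<subseteq> active m g p.
          pos_lin_dependent K (\<lambda>i. grad A G (h i) p) J (\<lambda>j. grad A G (g j) p) \<longrightarrow>
          (\<forall>q \<in> riem_ball A G p \<epsilon>.
             lin_dependent K (\<lambda>i. grad A G (h i) q) J (\<lambda>j. grad A G (g j) q)))))"

definition polar_cone ::
  "('a, 'e::euclidean_space) chart set \<Rightarrow> ('a, 'e) metric \<Rightarrow> nat \<Rightarrow> nat \<Rightarrow>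
   (nat \<Rightarrow> 'a \<Rightarrow> real) \<Rightarrow> (nat \<Rightarrow> 'a \<Rightarrow> real) \<Rightarrow> 'a \<Rightarrow> ('a, 'e) tvec set" where
  "polar_cone A G s m h g p =
     {(\<Sum>i=1..s. lam i *\<^sub>R grad A G (h i) p) + (\<Sum>j\<in>active m g p. mu j *\<^sub>R grad A G (g j) p)
       | lam mu. \<forall>j\<in>active m g p. mu j \<ge> 0}"

definition J_minus ::
  "('a, 'e::euclidean_space) chart set \<Rightarrow> ('a, 'e) metric \<Rightarrow> nat \<Rightarrow> nat \<Rightarrow>
   (nat \<Rightarrow> 'a \<Rightarrow> real) \<Rightarrow> (nat \<Rightarrow> 'a \<Rightarrow> real) \<Rightarrow> 'a \<Rightarrow> nat set" where
  "J_minus A G s m h g p = {j \<in> active m g p. - grad A G (g j) p \<in> polar_cone A G s m h g p}"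

definition CRSC ::
  "('a::topological_space, 'e::euclidean_space) chart set \<Rightarrow> ('a, 'e) metric \<Rightarrow> nat \<Rightarrow> nat \<Rightarrow>
   (nat \<Rightarrow> 'a \<Rightarrow> real) \<Rightarrow> (nat \<Rightarrow> 'a \<Rightarrow> real) \<Rightarrow> 'a \<Rightarrow> bool" where
  "CRSC A G s m h g p \<longleftrightarrow> (\<exists>\<epsilon>>0. \<exists>r. \<forall>q \<in> riem_ball A G p \<epsilon>.
     dim ((\<lambda>i. grad A G (h i) q) ` {1..s} \<union>
          (\<lambda>j. grad A G (g j) q) ` J_minus A G s m h g p) = r)"


section \<open>The safeguarded augmented Lagrangian algorithm\<close>

definition aug_lagrangian ::
  "nat \<Rightarrow> nat \<Rightarrow> ('a \<Rightarrow> real) \<Rightarrow> (nat \<Rightarrow> 'a \<Rightarrow> real) \<Rightarrow> (nat \<Rightarrow> 'a \<Rightarrow> real) \<Rightarrow> real \<Rightarrow>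
   'a \<Rightarrow> (nat \<Rightarrow> real) \<Rightarrow> (nat \<Rightarrow> real) \<Rightarrow> real" where
  "aug_lagrangian s m f h g \<rho> q lam mu = f q + \<rho> / 2 *
     ((L2_set (\<lambda>i. h i q + lam i / \<rho>) {1..s})\<^sup>2 +
      (L2_set (\<lambda>j. max 0 (g j q + mu j / \<rho>)) {1..m})\<^sup>2)"

text \<open>
  \<open>p\<close> is an infinite run of the algorithm. Iterations are numbered from \<open>1\<close>; the starting point
  \<open>p 0\<close> is arbitrary, and the values at index \<open>0\<close> of the other sequences play no role.
\<close>

definition al_sequence ::
  "('a, 'e::euclidean_space) chart set \<Rightarrow> ('a, 'e) metric \<Rightarrow> nat \<Rightarrow> nat \<Rightarrow> ('a \<Rightarrow> real) \<Rightarrow>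
   (nat \<Rightarrow> 'a \<Rightarrow> real) \<Rightarrow> (nat \<Rightarrow> 'a \<Rightarrow> real) \<Rightarrow> (nat \<Rightarrow> 'a) \<Rightarrow> bool" where
  "al_sequence A G s m f h g p \<longleftrightarrow>
    (\<exists>(\<tau>::real) (\<gamma>::real) (lmin::real) (lmax::real) (mmax::real) (\<epsilon>::nat \<Rightarrow> real) (\<rho>::nat \<Rightarrow> real)
      (lbar::nat \<Rightarrow> nat \<Rightarrow> real) (mbar::nat \<Rightarrow> nat \<Rightarrow> real)
      (lam::nat \<Rightarrow> nat \<Rightarrow> real) (mu::nat \<Rightarrow> nat \<Rightarrow> real) (V::nat \<Rightarrow> nat \<Rightarrow> real).
      0 \<le> \<tau> \<and> \<tau> < 1 \<and> \<gamma> > 1 \<and> lmin < lmax \<and> mmax > 0 \<and> \<rho> 1 > 0 \<and>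
      (\<forall>k\<ge>1. \<epsilon> k \<ge> 0) \<and> \<epsilon> \<longlonglongrightarrow> 0 \<and>
      (\<forall>k\<ge>1.
        (\<forall>i\<in>{1..s}. lbar k i \<in> {lmin..lmax}) \<and>
        (\<forall>j\<in>{1..m}. mbar k j \<in> {0..mmax}) \<and>
        tnorm G (p k)
          (grad A G (\<lambda>q. aug_lagrangian s m f h g (\<rho> k) q (lbar k) (mbar k)) (p k)) \<le> \<epsilon> k \<and>
        (\<forall>i\<in>{1..s}. lam k i = lbar k i + \<rho> k * h i (p k)) \<and>
        (\<forall>j\<in>{1..m}. mu k j = max 0 (mbar k j + \<rho> k * g j (p k))) \<and>
        (\<forall>j\<in>{1..m}. V k j = (mu k j - mbar k j) / \<rho> k) \<and>
        \<rho> (k + 1) =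
          (if k = 1 \<or>
              max (L2_set (\<lambda>i. h i (p k)) {1..s}) (L2_set (V k) {1..m})
              \<le> \<tau> * max (L2_set (\<lambda>i. h i (p (k - 1))) {1..s}) (L2_set (V (k - 1)) {1..m})
           then \<rho> k else \<gamma> * \<rho> k)))"

definition is_limit_point :: "(nat \<Rightarrow> 'a::topological_space) \<Rightarrow> 'a \<Rightarrow> bool" where
  "is_limit_point u x \<longleftrightarrow> (\<exists>r :: nat \<Rightarrow> nat. strict_mono r \<and> (u \<circ> r) \<longlonglongrightarrow> x)"

end

theory Submission
  imports Defs
begin

text \<open>
  The iterates make the gradient of the augmented Lagrangian tend to zero, and by the chain rule
  this gradient is that of the ordinary Lagrangian with the updated multipliers. Along a
  subsequence converging to \<open>p\<close> the multipliers of the inactive constraints eventually vanish: if the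
  penalty parameter tends to infinity, the negative term \<open>\<rho> g\<^sub>j\<close> outweighs the bounded safeguard;
  otherwise the test that keeps the penalty parameter succeeds from some index on, the residuals \<open>V\<close> tend to zero, and
  so the update cannot change the multiplier by the amount that a negative \<open>g\<^sub>j\<close> and a
  positive new multiplier would force. Hence \<open>p\<close> is approximately stationary
  (\<open>approximate_KKT_sequence\<close>): \<open>-grad f\<close> at \<open>p\<close> is a limit of combinations of the constraint
  gradients at points tending to \<open>p\<close>, with non-negative coefficients on the active inequality
  constraints. What is left is to show that the limit of such combinations is again such a
  combination. The coefficients may be unbounded, but dividing by their size yields a nontrivial
  relation at the limit (\<open>combination_limit_or_relation\<close>), so it is enough to rewrite the
  combinations in a form in which the constraint qualification forbids this relation.

  For RCPLD (\<open>combination_limit_RCPLD\<close>), constant rank lets the basis \<open>K\<close> carry the equality part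
  near \<open>p\<close>, and Caratheodory's reduction makes the gradients that occur linearly independent at
  the nearby points; a relation at \<open>p\<close> would be a positive-linear dependence, which RCPLD carries
  over to linear dependence nearby.

  For CRSC (\<open>combination_limit_CRSC\<close>), the equality constraints are taken together with the
  constraints in \<open>J_minus\<close>. Both signs of their gradients at \<open>p\<close> lie in the cone, so their
  coefficients may have any sign, and a basis of their span at \<open>p\<close> still spans nearby. A limiting
  relation with a positive coefficient on a remaining constraint would put that constraint into
  \<open>J_minus\<close>, and one without such a coefficient contradicts the independence of the basis.

  All of this is linear algebra in one Euclidean space, because it is carried out with the
  coordinates of the differentials in a chart around \<open>p\<close>. At each point the gradient is the image of this
  covector under an injective linear map, namely the inverse of the metric
  (\<open>gradient_from_covector\<close>), so that linear relations, ranks and cones of gradients and of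
  covectors correspond to each other, and limits are taken of covectors rather than gradients. The
  metric enters analytically in two places: small gradients have small covectors
  (\<open>covector_vanishes\<close>), and Riemannian balls contain neighbourhoods
  (\<open>riem_ball_contains_neighbourhood\<close>).
\<close>

section \<open>Independent families\<close>

text \<open>
  Independence as an indexed family, so that repeated vectors are dependent, in agreement with
  the reading of gradients as multisets.
\<close>

definition indep_family :: "'i set \<Rightarrow> ('i \<Rightarrow> 'v::real_vector) \<Rightarrow> bool" where
  "indep_family I v \<longleftrightarrow> (\<forall>a. (\<Sum>i\<in>I. a i *\<^sub>R v i) = 0 \<longrightarrow> (\<forall>i\<in>I. a i = 0))"

lemma indep_family_iff:
  assumes "finite I"
  shows "indep_family I v \<longleftrightarrow> inj_on v I \<and> independent (v ` I)"
proof
  assume L: "indep_family I v"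
  have inj: "inj_on v I"
  proof (rule inj_onI, rule ccontr)
    fix i j assume ij: "i \<in> I" "j \<in> I" "v i = v j" "i \<noteq> j"
    define a where "a = (\<lambda>l. if l = i then 1 else if l = j then - 1 else 0 :: real)"
    have "(\<Sum>l\<in>I. a l *\<^sub>R v l) = (\<Sum>l\<in>{i,j}. a l *\<^sub>R v l)"
      by (rule sum.mono_neutral_right) (use ij assms in \<open>auto simp: a_def\<close>)
    also have "\<dots> = 0" using ij by (simp add: a_def)
    finally have "a i = 0" using L ij unfolding indep_family_def by blast
    then show False by (simp add: a_def)
  qed
  have "independent (v ` I)"
  proof (rule ccontr)
    assume "\<not> independent (v ` I)"
    then obtain u where u: "\<exists>x\<in>v ` I. u x \<noteq> 0" "(\<Sum>x\<in>v ` I. u x *\<^sub>R x) = 0"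
      using assms by (auto simp: dependent_finite)
    then have "(\<Sum>i\<in>I. u (v i) *\<^sub>R v i) = 0" using inj by (simp add: sum.reindex)
    with L have "\<forall>i\<in>I. u (v i) = 0"
      unfolding indep_family_def by (elim allE[of _ "\<lambda>i. u (v i)"]) simp
    with u(1) show False by blast
  qed
  with inj show "inj_on v I \<and> independent (v ` I)" by blast
next
  assume R: "inj_on v I \<and> independent (v ` I)"
  show "indep_family I v"
    unfolding indep_family_def
  proof (intro allI impI ballI)
    fix a :: "_ \<Rightarrow> real" and i assume a: "(\<Sum>i\<in>I. a i *\<^sub>R v i) = 0" and i: "i \<in> I"
    define u where "u = (\<lambda>x. a (the_inv_into I v x))"
    have "(\<Sum>x\<in>v ` I. u x *\<^sub>R x) = (\<Sum>i\<in>I. a i *\<^sub>R v i)"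
      using R by (simp add: sum.reindex u_def the_inv_into_f_f)
    with a have "u (v i) = 0" using R i assms dependent_finite[of "v ` I"] by auto
    then show "a i = 0" using R i by (simp add: u_def the_inv_into_f_f)
  qed
qed

lemma span_indep_family:
  assumes "finite I" "indep_family I v" "x \<in> span (v ` I)"
  shows "\<exists>c. x = (\<Sum>i\<in>I. c i *\<^sub>R v i)"
proof -
  have inj: "inj_on v I" using assms indep_family_iff by blast
  obtain u where "x = (\<Sum>y\<in>v ` I. u y *\<^sub>R y)"
    using assms span_finite[of "v ` I"] by auto
  then have "x = (\<Sum>i\<in>I. u (v i) *\<^sub>R v i)" using inj by (simp add: sum.reindex)
  then show ?thesis by (rule exI[of _ "\<lambda>i. u (v i)"])
qed

lemma indep_family_cong:
  assumes "\<And>i. i \<in> I \<Longrightarrow> v i = w i"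
  shows "indep_family I v \<longleftrightarrow> indep_family I w"
proof -
  have "(\<Sum>i\<in>I. a i *\<^sub>R v i) = (\<Sum>i\<in>I. a i *\<^sub>R w i)" for a
    using assms by (intro sum.cong) auto
  then show ?thesis unfolding indep_family_def by simp
qed

lemma indep_family_linear_image:
  assumes "linear S" "inj S"
  shows "indep_family I (\<lambda>i. S (v i)) \<longleftrightarrow> indep_family I v"
proof -
  have "(\<Sum>i\<in>I. a i *\<^sub>R S (v i)) = S (\<Sum>i\<in>I. a i *\<^sub>R v i)" for a
    using assms(1) by (simp add: linear_sum linear_scale)
  moreover have "S x = 0 \<longleftrightarrow> x = 0" for x
    using assms linear_injective_0 linear_0 by (metis injD)
  ultimately show ?thesis unfolding indep_family_def by simp
qed

lemma dim_linear_image: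
  fixes S :: "'v::real_vector \<Rightarrow> 'w::real_vector"
  assumes S: "linear S" "inj S"
  shows "dim (S ` X) = dim X"
proof -
  obtain B where B: "B \<subseteq> X" "independent B" "X \<subseteq> span B" "card B = dim X" by (rule basis_exists)
  have "independent (S ` B)"
    using linear_independent_injective_image[OF S(1) B(2)] S(2) inj_on_subset by blast
  moreover have "S ` X \<subseteq> span (S ` B)" using B(3) by (simp add: linear_span_image[OF S(1)] image_mono)
  ultimately have "card (S ` B) = dim (S ` X)"
    using B(1) by (intro basis_card_eq_dim) auto
  then show ?thesis using B(4) S(2) card_image inj_on_subset by (metis subset_UNIV)
qed

section \<open>Limits of linear combinations\<close>

lemma bounded_family_convergent_subsequence:
  fixes b :: "nat \<Rightarrow> 'i \<Rightarrow> real"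
  assumes "finite I" "\<And>k i. i \<in> I \<Longrightarrow> \<bar>b k i\<bar> \<le> B i"
  shows "\<exists>r l. strict_mono r \<and> (\<forall>i\<in>I. (\<lambda>k. b (r k) i) \<longlonglongrightarrow> l i)"
  using assms
proof (induction I)
  case empty
  then show ?case by (auto intro!: exI[of _ id] simp: strict_mono_def)
next
  case (insert i I)
  then obtain r l where r: "strict_mono r" "\<forall>i\<in>I. (\<lambda>k. b (r k) i) \<longlonglongrightarrow> l i" by auto
  have "bounded (range (\<lambda>k. b (r k) i))"
    using insert.prems by (auto simp: bounded_iff)
  then obtain x r' where r': "strict_mono r'" "((\<lambda>k. b (r k) i) \<circ> r') \<longlonglongrightarrow> x"
    using bounded_imp_convergent_subsequence by blast
  have "\<forall>j\<in>insert i I. (\<lambda>k. b ((r \<circ> r') k) j) \<longlonglongrightarrow> (l(i := x)) j"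
  proof
    fix j assume j: "j \<in> insert i I"
    show "(\<lambda>k. b ((r \<circ> r') k) j) \<longlonglongrightarrow> (l(i := x)) j"
    proof (cases "j = i")
      case True then show ?thesis using r' by (simp add: o_def)
    next
      case False
      then have "((\<lambda>k. b (r k) j) \<circ> r') \<longlonglongrightarrow> l j"
        using LIMSEQ_subseq_LIMSEQ[OF _ r'(1), of "\<lambda>k. b (r k) j" "l j"] r j by auto
      then show ?thesis using False by (simp add: o_def)
    qed
  qed
  then show ?case using strict_mono_o[OF r(1) r'(1)] by blast
qed

text \<open>
  Coefficient vectors of \<open>l\<^sup>1\<close>-norm \<open>1\<close> range over a compact set, and the norm survives in the limit,
  which keeps the limiting relation nontrivial.
\<close>

lemma normalized_relation_limit:
  fixes v :: "nat \<Rightarrow> 'i \<Rightarrow> 'v::real_normed_vector"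
  assumes fin: "finite I" and v: "\<And>i. i \<in> I \<Longrightarrow> (\<lambda>k. v k i) \<longlonglongrightarrow> vl i"
    and norm1: "\<And>k. (\<Sum>i\<in>I. \<bar>b k i\<bar>) = 1"
    and rel: "(\<lambda>k. \<Sum>i\<in>I. b k i *\<^sub>R v k i) \<longlonglongrightarrow> 0"
    and nonneg: "\<And>k i. i \<in> P \<Longrightarrow> b k i \<ge> 0" and P: "P \<subseteq> I"
  shows "\<exists>c. (\<forall>i\<in>P. c i \<ge> 0) \<and> (\<exists>i\<in>I. c i \<noteq> 0) \<and> (\<Sum>i\<in>I. c i *\<^sub>R vl i) = 0"
proof -
  have "\<bar>b k i\<bar> \<le> 1" if "i \<in> I" for k i
    using member_le_sum[of i I "\<lambda>i. \<bar>b k i\<bar>"] that fin norm1[of k] by auto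
  then obtain r c where r: "strict_mono r" "\<forall>i\<in>I. (\<lambda>k. b (r k) i) \<longlonglongrightarrow> c i"
    using bounded_family_convergent_subsequence[OF fin, of b "\<lambda>_. 1"] by blast
  have "(\<lambda>k. \<Sum>i\<in>I. b (r k) i *\<^sub>R v (r k) i) \<longlonglongrightarrow> (\<Sum>i\<in>I. c i *\<^sub>R vl i)"
    using r v LIMSEQ_subseq_LIMSEQ[OF v r(1)]
    by (intro tendsto_sum tendsto_scaleR) (auto simp: o_def)
  moreover have "(\<lambda>k. \<Sum>i\<in>I. b (r k) i *\<^sub>R v (r k) i) \<longlonglongrightarrow> 0"
    using LIMSEQ_subseq_LIMSEQ[OF rel r(1)] by (simp add: o_def)
  ultimately have 1: "(\<Sum>i\<in>I. c i *\<^sub>R vl i) = 0" using LIMSEQ_unique by blast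
  have "(\<lambda>k. \<Sum>i\<in>I. \<bar>b (r k) i\<bar>) \<longlonglongrightarrow> (\<Sum>i\<in>I. \<bar>c i\<bar>)"
    using r by (intro tendsto_sum tendsto_rabs) auto
  then have "(\<lambda>k::nat. 1) \<longlonglongrightarrow> (\<Sum>i\<in>I. \<bar>c i\<bar>)" unfolding norm1 .
  then have "(\<Sum>i\<in>I. \<bar>c i\<bar>) = 1" using LIMSEQ_unique tendsto_const by blast
  then have 2: "\<exists>i\<in>I. c i \<noteq> 0" by (metis abs_zero sum.neutral zero_neq_one)
  have "\<forall>i\<in>P. c i \<ge> 0"
  proof
    fix i assume i: "i \<in> P"
    then have "(\<lambda>k. b (r k) i) \<longlonglongrightarrow> c i" using r(2) P by blast
    then show "c i \<ge> 0" by (rule LIMSEQ_le_const) (use i nonneg in blast)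
  qed
  with 1 2 show ?thesis by blast
qed

text \<open>
  Otherwise there are infinitely many nontrivial relations, and after normalization these have a
  nontrivial relation as limit.
\<close>

lemma indep_family_eventually:
  fixes v :: "nat \<Rightarrow> 'i \<Rightarrow> 'v::real_normed_vector"
  assumes fin: "finite I" and v: "\<And>i. i \<in> I \<Longrightarrow> (\<lambda>k. v k i) \<longlonglongrightarrow> vl i"
    and indep: "indep_family I vl"
  shows "\<forall>\<^sub>F k in sequentially. indep_family I (v k)"
proof (rule ccontr)
  assume "\<not> ?thesis"
  then obtain r :: "nat \<Rightarrow> nat" where r: "strict_mono r" "\<And>k. \<not> indep_family I (v (r k))"
    using not_eventually_sequentiallyD by blast
  then have "\<forall>k. \<exists>a. (\<Sum>i\<in>I. a i *\<^sub>R v (r k) i) = 0 \<and> (\<exists>i\<in>I. a i \<noteq> 0)"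
    unfolding indep_family_def by blast
  then obtain a where a: "\<And>k. (\<Sum>i\<in>I. a k i *\<^sub>R v (r k) i) = 0" "\<And>k. \<exists>i\<in>I. a k i \<noteq> (0::real)"
    by metis
  define t where "t k = (\<Sum>i\<in>I. \<bar>a k i\<bar>)" for k
  have t: "t k > 0" for k
  proof -
    obtain i where "i \<in> I" "a k i \<noteq> 0" using a by blast
    then show ?thesis unfolding t_def using fin by (intro sum_pos2[of I i]) auto
  qed
  have rel: "(\<Sum>i\<in>I. (a k i / t k) *\<^sub>R v (r k) i) = 0" for k
  proof -
    have "(\<Sum>i\<in>I. (a k i / t k) *\<^sub>R v (r k) i) = (1 / t k) *\<^sub>R (\<Sum>i\<in>I. a k i *\<^sub>R v (r k) i)"
      by (simp add: scaleR_sum_right)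
    then show ?thesis using a by simp
  qed
  have "(\<Sum>i\<in>I. \<bar>a k i / t k\<bar>) = 1" for k
  proof -
    have "(\<Sum>i\<in>I. \<bar>a k i / t k\<bar>) = t k / t k"
      using t[of k] by (simp add: abs_divide sum_divide_distrib[symmetric] t_def[symmetric])
    then show ?thesis using t[of k] by simp
  qed
  moreover have "(\<lambda>k. v (r k) i) \<longlonglongrightarrow> vl i" if "i \<in> I" for i
    using LIMSEQ_subseq_LIMSEQ[OF v[OF that] r(1)] by (simp add: o_def)
  ultimately have "\<exists>c. (\<forall>i\<in>{}. c i \<ge> 0) \<and> (\<exists>i\<in>I. c i \<noteq> 0) \<and> (\<Sum>i\<in>I. c i *\<^sub>R vl i) = 0"
    using fin rel by (intro normalized_relation_limit[where v = "\<lambda>k. v (r k)" and b = "\<lambda>k i. a k i / t k"]) auto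
  then show False using indep unfolding indep_family_def by blast
qed

text \<open>
  Adjoining the negative of the combination itself as one more vector with coefficient \<open>1\<close> turns
  the combination into a relation, which can be normalized. In the limit either the coefficient of
  the additional vector is positive, and dividing by it recovers \<open>w\<close>, or it is zero, and a
  nontrivial relation among the other vectors remains.
\<close>

lemma combination_limit_or_relation:
  fixes v :: "nat \<Rightarrow> 'i \<Rightarrow> 'v::real_normed_vector"
  assumes fin: "finite I" and v: "\<And>i. i \<in> I \<Longrightarrow> (\<lambda>k. v k i) \<longlonglongrightarrow> vl i"
    and w: "(\<lambda>k. \<Sum>i\<in>I. a k i *\<^sub>R v k i) \<longlonglongrightarrow> w"
    and nonneg: "\<And>k i. i \<in> P \<Longrightarrow> a k i \<ge> 0" and P: "P \<subseteq> I"
  shows "(\<exists>c. (\<forall>i\<in>P. c i \<ge> 0) \<and> (\<Sum>i\<in>I. c i *\<^sub>R vl i) = w) \<or>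
    (\<exists>c. (\<forall>i\<in>P. c i \<ge> 0) \<and> (\<exists>i\<in>I. c i \<noteq> 0) \<and> (\<Sum>i\<in>I. c i *\<^sub>R vl i) = 0)"
proof -
  define t where "t k = 1 + (\<Sum>i\<in>I. \<bar>a k i\<bar>)" for k
  define b where "b k = case_option (1 / t k) (\<lambda>i. a k i / t k)" for k
  define V where "V k = case_option (- (\<Sum>i\<in>I. a k i *\<^sub>R v k i)) (v k)" for k
  define Vl where "Vl = case_option (- w) vl"
  let ?I = "insert None (Some ` I)" and ?P = "insert None (Some ` P)"
  have t: "t k \<ge> 1" for k unfolding t_def by (simp add: sum_nonneg)
  have sumI: "(\<Sum>i\<in>?I. F i) = F None + (\<Sum>i\<in>I. F (Some i))" for F :: "'i option \<Rightarrow> 'b::comm_monoid_add"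
    using fin by (simp add: sum.reindex)
  have "\<exists>c. (\<forall>i\<in>?P. c i \<ge> 0) \<and> (\<exists>i\<in>?I. c i \<noteq> 0) \<and> (\<Sum>i\<in>?I. c i *\<^sub>R Vl i) = 0"
  proof (rule normalized_relation_limit[where v = V and b = b])
    show "(\<lambda>k. V k i) \<longlonglongrightarrow> Vl i" if "i \<in> ?I" for i
      using that v tendsto_minus[OF w] by (auto simp: V_def Vl_def)
    show "(\<Sum>i\<in>?I. \<bar>b k i\<bar>) = 1" for k
    proof -
      have "(\<Sum>i\<in>?I. \<bar>b k i\<bar>) = (1 + (\<Sum>i\<in>I. \<bar>a k i\<bar>)) / t k"
        unfolding sumI using t[of k] by (simp add: b_def abs_divide sum_divide_distrib add_divide_distrib)
      then show ?thesis using t[of k] unfolding t_def by simp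
    qed
    have "(\<Sum>i\<in>?I. b k i *\<^sub>R V k i) = 0" for k
    proof -
      have "(\<Sum>i\<in>I. (a k i / t k) *\<^sub>R v k i) = (1 / t k) *\<^sub>R (\<Sum>i\<in>I. a k i *\<^sub>R v k i)"
        by (simp add: scaleR_sum_right)
      then show ?thesis unfolding sumI by (simp add: b_def V_def)
    qed
    then show "(\<lambda>k. \<Sum>i\<in>?I. b k i *\<^sub>R V k i) \<longlonglongrightarrow> 0" by simp
    show "b k i \<ge> 0" if "i \<in> ?P" for k i
      using that nonneg[of _ k] t[of k] by (auto simp: b_def)
  qed (use fin P in auto)
  then obtain c where c: "\<forall>i\<in>?P. c i \<ge> 0" "\<exists>i\<in>?I. c i \<noteq> 0"
      "(\<Sum>i\<in>I. c (Some i) *\<^sub>R vl i) = c None *\<^sub>R w"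
    unfolding sumI by (auto simp: Vl_def)
  show ?thesis
  proof (cases "c None = 0")
    case True
    then show ?thesis using c by (intro disjI2 exI[of _ "\<lambda>i. c (Some i)"]) auto
  next
    case False
    have "(\<Sum>i\<in>I. (c (Some i) / c None) *\<^sub>R vl i) = (1 / c None) *\<^sub>R (\<Sum>i\<in>I. c (Some i) *\<^sub>R vl i)"
      by (simp add: scaleR_sum_right)
    also have "\<dots> = w" using False c by simp
    finally show ?thesis using c by (intro disjI1 exI[of _ "\<lambda>i. c (Some i) / c None"]) auto
  qed
qed

section \<open>Limits under the rank conditions\<close>

text \<open>
  Caratheodory's theorem for the sum of a subspace and a cone. A relation must involve some
  index of \<open>P\<close>, because the family over \<open>F\<close> is independent; moving along the relation until the
  first coefficient over \<open>P\<close> reaches zero removes one index and keeps all signs.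
\<close>

lemma conic_caratheodory:
  fixes v :: "'i \<Rightarrow> 'v::real_vector"
  assumes "finite F" "finite P" "F \<inter> P = {}" "indep_family F v" "\<And>i. i \<in> P \<Longrightarrow> a i \<ge> 0"
  shows "\<exists>J c. J \<subseteq> P \<and> indep_family (F \<union> J) v \<and> (\<forall>i\<in>J. c i \<ge> 0) \<and>
    (\<Sum>i\<in>F \<union> J. c i *\<^sub>R v i) = (\<Sum>i\<in>F \<union> P. a i *\<^sub>R v i)"
  using assms(2,3,5)
proof (induction P arbitrary: a rule: finite_psubset_induct)
  case (psubset P)
  show ?case
  proof (cases "indep_family (F \<union> P) v")
    case True
    then show ?thesis using psubset.prems by blast
  next
    case False
    then obtain c0 where c0: "(\<Sum>i\<in>F \<union> P. c0 i *\<^sub>R v i) = 0" "\<exists>i\<in>F \<union> P. c0 i \<noteq> 0"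
      unfolding indep_family_def by blast
    have "\<exists>i\<in>P. c0 i \<noteq> 0"
    proof (rule ccontr)
      assume n: "\<not> ?thesis"
      have "(\<Sum>i\<in>F \<union> P. c0 i *\<^sub>R v i) = (\<Sum>i\<in>F. c0 i *\<^sub>R v i)"
        by (rule sum.mono_neutral_right) (use n assms(1) psubset.hyps in auto)
      then have "\<forall>i\<in>F. c0 i = 0" using c0 assms(4) unfolding indep_family_def by metis
      with n c0 show False by auto
    qed
    then obtain i0 where i0: "i0 \<in> P" "c0 i0 \<noteq> 0" by blast
    \<comment> \<open>The sign makes some coefficient over \<open>P\<close> positive, so that the step length \<open>t\<close> is finite.\<close>
    define c where "c i = sgn (c0 i0) * c0 i" for i
    have c: "(\<Sum>i\<in>F \<union> P. c i *\<^sub>R v i) = 0" "c i0 > 0"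
    proof -
      have "(\<Sum>i\<in>F \<union> P. c i *\<^sub>R v i) = sgn (c0 i0) *\<^sub>R (\<Sum>i\<in>F \<union> P. c0 i *\<^sub>R v i)"
        by (simp add: scaleR_sum_right c_def)
      then show "(\<Sum>i\<in>F \<union> P. c i *\<^sub>R v i) = 0" using c0 by simp
      show "c i0 > 0" using i0 by (auto simp: c_def sgn_if)
    qed
    define Q where "Q = {i \<in> P. c i > 0}"
    have Q: "finite Q" "Q \<noteq> {}" using psubset.hyps i0 c by (auto simp: Q_def)
    define t where "t = Min ((\<lambda>i. a i / c i) ` Q)"
    have "t \<in> (\<lambda>i. a i / c i) ` Q" unfolding t_def using Q by (intro Min_in) auto
    then obtain j where j: "j \<in> P" "c j > 0" "t = a j / c j" by (auto simp: Q_def)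
    have tle: "t \<le> a i / c i" if "i \<in> Q" for i
      unfolding t_def using Q that by (intro Min_le) auto
    have t0: "t \<ge> 0" using j psubset.prems(2) by simp
    define a' where "a' i = a i - t * c i" for i
    have a'nn: "a' i \<ge> 0" if "i \<in> P" for i
    proof (cases "c i > 0")
      case True
      then show ?thesis using tle[of i] that by (auto simp: a'_def Q_def field_simps)
    next
      case False
      then have "t * c i \<le> 0" using t0 by (simp add: mult_nonneg_nonpos)
      then show ?thesis using psubset.prems(2)[OF that] by (simp add: a'_def)
    qed
    have a'j: "a' j = 0" using j by (simp add: a'_def)
    obtain J d where J: "J \<subseteq> P - {j}" "indep_family (F \<union> J) v" "\<forall>i\<in>J. d i \<ge> 0"
       "(\<Sum>i\<in>F \<union> J. d i *\<^sub>R v i) = (\<Sum>i\<in>F \<union> (P - {j}). a' i *\<^sub>R v i)"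
      using psubset.IH[of "P - {j}" a'] j psubset.prems a'nn by auto
    have "(\<Sum>i\<in>F \<union> (P - {j}). a' i *\<^sub>R v i) = (\<Sum>i\<in>F \<union> P. a' i *\<^sub>R v i)"
      by (rule sum.mono_neutral_left) (use a'j assms(1) psubset.hyps in auto)
    also have "\<dots> = (\<Sum>i\<in>F \<union> P. a i *\<^sub>R v i) - t *\<^sub>R (\<Sum>i\<in>F \<union> P. c i *\<^sub>R v i)"
      by (simp add: a'_def scaleR_left_diff_distrib sum_subtractf scaleR_sum_right)
    also have "\<dots> = (\<Sum>i\<in>F \<union> P. a i *\<^sub>R v i)" using c by simp
    finally show ?thesis using J by (metis Diff_subset subset_trans)
  qed
qed

text \<open>
  Independence of the basis persists nearby, and since the rank stays equal to its size the
  basis still spans.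
\<close>

lemma constant_rank_basis_eventually:
  fixes v :: "nat \<Rightarrow> 'i \<Rightarrow> 'v::euclidean_space"
  assumes fin: "finite I" and v: "\<And>i. i \<in> I \<Longrightarrow> (\<lambda>k. v k i) \<longlonglongrightarrow> vl i"
    and K: "K \<subseteq> I" "indep_family K vl" "span (vl ` K) = span (vl ` I)"
    and rank: "\<And>k. dim (v k ` I) = dim (vl ` I)"
  shows "\<forall>\<^sub>F k in sequentially. indep_family K (v k) \<and> span (v k ` K) = span (v k ` I)"
proof -
  have finK: "finite K" using fin K finite_subset by blast
  have "\<forall>\<^sub>F k in sequentially. indep_family K (v k)"
    by (rule indep_family_eventually[OF finK _ K(2)]) (use v K(1) in auto)
  then show ?thesis
  proof eventually_elim
    case (elim k)
    have "dim (u ` K) = card K" if "indep_family K u" for u :: "'i \<Rightarrow> 'v"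
      using that indep_family_iff[OF finK] by (metis card_image dim_eq_card_independent)
    then have "dim (v k ` K) = dim (vl ` K)" using elim K by simp
    also have "\<dots> = dim (v k ` I)" using K rank by (metis dim_span)
    finally have "span (v k ` K) = span (v k ` I)"
      using K by (intro dim_eq_span) auto
    with elim show ?case by blast
  qed
qed

lemma replace_free_part_by_basis:
  fixes v :: "'i \<Rightarrow> 'v::real_vector"
  assumes fin: "finite F" "finite Q" "F \<inter> Q = {}"
    and K: "K \<subseteq> F" "indep_family K v" "span (v ` K) = span (v ` F)"
  shows "\<exists>d. (\<forall>i\<in>Q. d i = a i) \<and> (\<Sum>i\<in>K \<union> Q. d i *\<^sub>R v i) = (\<Sum>i\<in>F \<union> Q. a i *\<^sub>R v i)"
proof -
  have finK: "finite K" using fin(1) K(1) finite_subset by blast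
  have KQ: "K \<inter> Q = {}" using K(1) fin(3) by blast
  have "(\<Sum>i\<in>F. a i *\<^sub>R v i) \<in> span (v ` F)"
    by (intro span_sum span_scale span_base imageI)
  then obtain e where e: "(\<Sum>i\<in>F. a i *\<^sub>R v i) = (\<Sum>i\<in>K. e i *\<^sub>R v i)"
    using span_indep_family[OF finK K(2)] K(3) by blast
  define d where "d i = (if i \<in> K then e i else a i)" for i
  have "(\<Sum>i\<in>K \<union> Q. d i *\<^sub>R v i) = (\<Sum>i\<in>K. d i *\<^sub>R v i) + (\<Sum>i\<in>Q. d i *\<^sub>R v i)"
    using finK fin(2) KQ by (intro sum.union_disjoint) auto
  also have "(\<Sum>i\<in>K. d i *\<^sub>R v i) = (\<Sum>i\<in>F. a i *\<^sub>R v i)" by (simp add: e d_def)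
  also have "(\<Sum>i\<in>Q. d i *\<^sub>R v i) = (\<Sum>i\<in>Q. a i *\<^sub>R v i)"
    using KQ by (intro sum.cong) (auto simp: d_def)
  also have "(\<Sum>i\<in>F. a i *\<^sub>R v i) + (\<Sum>i\<in>Q. a i *\<^sub>R v i) = (\<Sum>i\<in>F \<union> Q. a i *\<^sub>R v i)"
    using fin by (simp add: sum.union_disjoint)
  finally have "(\<Sum>i\<in>K \<union> Q. d i *\<^sub>R v i) = (\<Sum>i\<in>F \<union> Q. a i *\<^sub>R v i)" .
  moreover have "\<forall>i\<in>Q. d i = a i" using KQ by (auto simp: d_def)
  ultimately show ?thesis by blast
qed

text \<open>
  Among the subsets \<open>J\<close> that occur in the reduced combinations, one occurs infinitely often. Along
  that subsequence the vectors over \<open>K \<union> J\<close> are independent, so the assumption \<open>pld\<close> excludes the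
  nontrivial relation that unbounded coefficients would produce.
\<close>

lemma combination_limit_RCPLD:
  fixes v :: "nat \<Rightarrow> 'i \<Rightarrow> 'v::euclidean_space"
  assumes fin: "finite F" "finite P" and disj: "F \<inter> P = {}"
    and v: "\<And>i. i \<in> F \<union> P \<Longrightarrow> (\<lambda>k. v k i) \<longlonglongrightarrow> vl i"
    and w: "(\<lambda>k. \<Sum>i\<in>F \<union> P. a k i *\<^sub>R v k i) \<longlonglongrightarrow> w"
    and nonneg: "\<And>k i. i \<in> P \<Longrightarrow> a k i \<ge> 0"
    and K: "K \<subseteq> F" "indep_family K vl" "span (vl ` K) = span (vl ` F)"
    and rank: "\<And>k. dim (v k ` F) = dim (vl ` F)"
    and pld: "\<And>J c k. J \<subseteq> P \<Longrightarrow> \<forall>i\<in>J. c i \<ge> 0 \<Longrightarrow> \<exists>i\<in>K \<union> J. c i \<noteq> 0 \<Longrightarrow>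
       (\<Sum>i\<in>K \<union> J. c i *\<^sub>R vl i) = 0 \<Longrightarrow> \<not> indep_family (K \<union> J) (v k)"
  shows "\<exists>c. (\<forall>i\<in>P. c i \<ge> 0) \<and> (\<Sum>i\<in>F \<union> P. c i *\<^sub>R vl i) = w"
proof -
  have finK: "finite K" using fin K finite_subset by blast
  have KP: "K \<inter> P = {}" using K disj by blast
  have "\<forall>\<^sub>F k in sequentially. indep_family K (v k) \<and> span (v k ` K) = span (v k ` F)"
    by (rule constant_rank_basis_eventually[OF fin(1) _ K rank]) (use v in auto)
  then obtain N where N: "\<And>k. k \<ge> N \<Longrightarrow> indep_family K (v k) \<and> span (v k ` K) = span (v k ` F)"
    unfolding eventually_sequentially by blast
  have "\<exists>J c. J \<subseteq> P \<and> indep_family (K \<union> J) (v k) \<and> (\<forall>i\<in>J. c i \<ge> 0) \<and>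
     (\<Sum>i\<in>K \<union> J. c i *\<^sub>R v k i) = (\<Sum>i\<in>F \<union> P. a k i *\<^sub>R v k i)" if k: "k \<ge> N" for k
  proof -
    obtain e where e: "\<forall>i\<in>P. e i = a k i"
        "(\<Sum>i\<in>K \<union> P. e i *\<^sub>R v k i) = (\<Sum>i\<in>F \<union> P. a k i *\<^sub>R v k i)"
      using replace_free_part_by_basis[OF fin disj K(1), of "v k" "a k"] N[OF k] by blast
    have "e i \<ge> 0" if "i \<in> P" for i using that e(1) nonneg by simp
    then show ?thesis
      using conic_caratheodory[OF finK fin(2) KP, of "v k" e] N[OF k] e(2) by simp
  qed
  then have "\<forall>k. \<exists>J c. J \<subseteq> P \<and> indep_family (K \<union> J) (v (k + N)) \<and> (\<forall>i\<in>J. c i \<ge> 0) \<and>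
     (\<Sum>i\<in>K \<union> J. c i *\<^sub>R v (k + N) i) = (\<Sum>i\<in>F \<union> P. a (k + N) i *\<^sub>R v (k + N) i)"
    by simp
  from choice[OF this] obtain J where "\<forall>k. \<exists>c. J k \<subseteq> P \<and> indep_family (K \<union> J k) (v (k + N)) \<and>
      (\<forall>i\<in>J k. c i \<ge> 0) \<and>
      (\<Sum>i\<in>K \<union> J k. c i *\<^sub>R v (k + N) i) = (\<Sum>i\<in>F \<union> P. a (k + N) i *\<^sub>R v (k + N) i)"
    by (elim exE)
  from choice[OF this] obtain c where "\<forall>k. J k \<subseteq> P \<and> indep_family (K \<union> J k) (v (k + N)) \<and>
      (\<forall>i\<in>J k. c k i \<ge> 0) \<and>
      (\<Sum>i\<in>K \<union> J k. c k i *\<^sub>R v (k + N) i) = (\<Sum>i\<in>F \<union> P. a (k + N) i *\<^sub>R v (k + N) i)"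
    by (elim exE)
  then have Jc: "\<And>k. J k \<subseteq> P" "\<And>k. indep_family (K \<union> J k) (v (k + N))"
     "\<And>k. \<forall>i\<in>J k. c k i \<ge> 0"
     "\<And>k. (\<Sum>i\<in>K \<union> J k. c k i *\<^sub>R v (k + N) i) = (\<Sum>i\<in>F \<union> P. a (k + N) i *\<^sub>R v (k + N) i)"
    by simp_all
  have "finite (range J)" using Jc(1) fin(2) by (intro finite_subset[of "range J" "Pow P"]) auto
  then obtain k0 where "infinite {k. J k = J k0}"
    using pigeonhole_infinite[of "UNIV::nat set" J] by auto
  then obtain r :: "nat \<Rightarrow> nat" where r: "strict_mono r" "\<And>k. J (r k) = J k0"
    using infinite_enumerate[of "{k. J k = J k0}"] by auto
  define R where "R k = r k + N" for k
  have R: "strict_mono R" using r(1) by (simp add: R_def strict_mono_def)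
  have vR: "(\<lambda>k. v (R k) i) \<longlonglongrightarrow> vl i" if "i \<in> F \<union> P" for i
    using LIMSEQ_subseq_LIMSEQ[OF v[OF that] R] by (simp add: o_def)
  have wR: "(\<lambda>k. \<Sum>i\<in>K \<union> J k0. c (r k) i *\<^sub>R v (R k) i) \<longlonglongrightarrow> w"
  proof -
    have "(\<lambda>k. \<Sum>i\<in>F \<union> P. a (R k) i *\<^sub>R v (R k) i) \<longlonglongrightarrow> w"
      using LIMSEQ_subseq_LIMSEQ[OF w R] by (simp add: o_def)
    then show ?thesis using Jc(4)[of "r _"] r(2) by (simp add: R_def)
  qed
  have sub: "K \<union> J k0 \<subseteq> F \<union> P" using K Jc(1) by blast
  have nn: "c (r k) i \<ge> 0" if "i \<in> J k0" for k i using Jc(3)[of "r k"] r that by simp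
  have "(\<exists>c. (\<forall>i\<in>J k0. c i \<ge> 0) \<and> (\<Sum>i\<in>K \<union> J k0. c i *\<^sub>R vl i) = w) \<or>
    (\<exists>c. (\<forall>i\<in>J k0. c i \<ge> 0) \<and> (\<exists>i\<in>K \<union> J k0. c i \<noteq> 0) \<and> (\<Sum>i\<in>K \<union> J k0. c i *\<^sub>R vl i) = 0)"
  proof (rule combination_limit_or_relation[OF _ _ wR nn])
    show "finite (K \<union> J k0)" using finite_subset[OF sub] fin by simp
  qed (use vR sub in blast)+
  then consider c' where "\<forall>i\<in>J k0. c' i \<ge> 0" "(\<Sum>i\<in>K \<union> J k0. c' i *\<^sub>R vl i) = w"
    | c' where "\<forall>i\<in>J k0. c' i \<ge> 0" "\<exists>i\<in>K \<union> J k0. c' i \<noteq> 0" "(\<Sum>i\<in>K \<union> J k0. c' i *\<^sub>R vl i) = 0"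
    by blast
  then show ?thesis
  proof cases
    case 1
    define d where "d i = (if i \<in> K \<union> J k0 then c' i else 0)" for i
    have "(\<Sum>i\<in>F \<union> P. d i *\<^sub>R vl i) = (\<Sum>i\<in>K \<union> J k0. d i *\<^sub>R vl i)"
      by (rule sum.mono_neutral_right) (use fin sub in \<open>auto simp: d_def\<close>)
    also have "\<dots> = w" using 1 by (simp add: d_def)
    finally have "(\<Sum>i\<in>F \<union> P. d i *\<^sub>R vl i) = w" .
    moreover have "\<forall>i\<in>P. d i \<ge> 0" using 1 KP by (auto simp: d_def)
    ultimately show ?thesis by blast
  next
    case 2
    then have "\<not> indep_family (K \<union> J k0) (v (R 0))" using pld[of "J k0"] Jc(1) by blast
    then show ?thesis using Jc(2)[of "r 0"] r(2) by (simp add: R_def)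
  qed
qed

text \<open>
  The linear span of the vectors over \<open>F \<union> M\<close> is contained in the cone \<open>C\<close>, so the signs of their
  coefficients are irrelevant for membership in \<open>C\<close>. This allows passing to a basis \<open>K\<close> of that span and
  using a combination over \<open>K \<union> (P - M)\<close>, whose coefficients stay bounded by the definition of
  \<open>M\<close> and the independence of \<open>K\<close>.
\<close>

lemma combination_limit_CRSC:
  fixes v :: "nat \<Rightarrow> 'i \<Rightarrow> 'v::euclidean_space"
  assumes fin: "finite F" "finite P" and disj: "F \<inter> P = {}"
    and v: "\<And>i. i \<in> F \<union> P \<Longrightarrow> (\<lambda>k. v k i) \<longlonglongrightarrow> vl i"
    and w: "(\<lambda>k. \<Sum>i\<in>F \<union> P. a k i *\<^sub>R v k i) \<longlonglongrightarrow> w"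
    and nonneg: "\<And>k i. i \<in> P \<Longrightarrow> a k i \<ge> 0"
    and cone: "C = {\<Sum>i\<in>F \<union> P. c i *\<^sub>R vl i | c. \<forall>i\<in>P. c i \<ge> 0}"
    and M: "M = {i \<in> P. - vl i \<in> C}"
    and rank: "\<And>k. dim (v k ` (F \<union> M)) = dim (vl ` (F \<union> M))"
  shows "w \<in> C"
proof -
  have finU: "finite (F \<union> P)" using fin by simp
  have memC: "x \<in> C" if "x = (\<Sum>i\<in>F \<union> P. c i *\<^sub>R vl i)" "\<forall>i\<in>P. c i \<ge> 0" for x c
    unfolding cone mem_Collect_eq by (rule exI[of _ c]) (use that in simp)
  have addC: "x + y \<in> C" if xy: "x \<in> C" "y \<in> C" for x y
  proof -
    obtain b c where "x = (\<Sum>i\<in>F \<union> P. b i *\<^sub>R vl i)" "y = (\<Sum>i\<in>F \<union> P. c i *\<^sub>R vl i)"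
      and nn: "\<forall>i\<in>P. b i \<ge> 0" "\<forall>i\<in>P. c i \<ge> 0" using xy unfolding cone by blast
    then have "x + y = (\<Sum>i\<in>F \<union> P. (b i + c i) *\<^sub>R vl i)"
      by (simp add: scaleR_add_left sum.distrib)
    then show ?thesis by (rule memC) (use nn in auto)
  qed
  have scaleC: "t *\<^sub>R x \<in> C" if xt: "x \<in> C" "t \<ge> 0" for x t
  proof -
    obtain b where "x = (\<Sum>i\<in>F \<union> P. b i *\<^sub>R vl i)"
      and nn: "\<forall>i\<in>P. b i \<ge> 0" using xt unfolding cone by blast
    then have "t *\<^sub>R x = (\<Sum>i\<in>F \<union> P. (t * b i) *\<^sub>R vl i)"
      by (simp add: scaleR_sum_right)
    then show ?thesis by (rule memC) (use nn xt in auto)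
  qed
  have unit: "d *\<^sub>R vl j \<in> C" if "j \<in> F \<union> P" "j \<in> P \<Longrightarrow> d \<ge> 0" for j d
  proof -
    have "d *\<^sub>R vl j = (\<Sum>i\<in>F \<union> P. (if i = j then d else 0) *\<^sub>R vl i)"
      using that finU by (simp add: if_distrib[of "\<lambda>x. x *\<^sub>R _"] sum.delta cong: if_cong)
    then show ?thesis by (rule memC) (use that in auto)
  qed
  have zeroC: "0 \<in> C" by (rule memC[of _ "\<lambda>_. 0"]) auto
  have sumC: "(\<Sum>i\<in>S. z i) \<in> C" if "\<And>i. i \<in> S \<Longrightarrow> z i \<in> C" for S and z :: "'i \<Rightarrow> 'v"
    using that by (induction S rule: infinite_finite_induct) (auto intro: addC zeroC)
  have lin: "d *\<^sub>R vl j \<in> C" if "j \<in> F \<union> M" for j d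
  proof (cases "j \<in> F")
    case True
    then show ?thesis using unit disj by blast
  next
    case False
    then have j: "j \<in> P" "- vl j \<in> C" using that M by auto
    show ?thesis
    proof (cases "d \<ge> 0")
      case True then show ?thesis using unit j by blast
    next
      case False then show ?thesis using scaleC[OF j(2), of "- d"] by simp
    qed
  qed
  obtain B where B: "B \<subseteq> vl ` (F \<union> M)" "independent B" "span B = span (vl ` (F \<union> M))"
    using basis_exists[of "vl ` (F \<union> M)"] span_minimal[OF _ subspace_span]
    by (metis span_mono subset_antisym)
  then obtain K where K0: "K \<subseteq> F \<union> M" "inj_on vl K" "B = vl ` K"
    using subset_image_inj by metis
  have MP: "M \<subseteq> P" using M by blast
  have finFM: "finite (F \<union> M)" using fin MP finite_subset by blast
  have finK: "finite K" using K0 finFM finite_subset by blast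
  have K: "K \<subseteq> F \<union> M" "indep_family K vl" "span (vl ` K) = span (vl ` (F \<union> M))"
    using K0 B by (auto simp: indep_family_iff[OF finK])
  have "\<forall>\<^sub>F k in sequentially. indep_family K (v k) \<and> span (v k ` K) = span (v k ` (F \<union> M))"
    by (rule constant_rank_basis_eventually[OF finFM _ K rank]) (use v MP in auto)
  then obtain N where N: "\<And>k. k \<ge> N \<Longrightarrow> indep_family K (v k) \<and> span (v k ` K) = span (v k ` (F \<union> M))"
    unfolding eventually_sequentially by blast
  define Q where "Q = P - M"
  have finQ: "finite Q" using fin by (simp add: Q_def)
  have FPQ: "F \<union> P = (F \<union> M) \<union> Q" "(F \<union> M) \<inter> Q = {}" using MP disj by (auto simp: Q_def)
  have "\<exists>c. (\<forall>i\<in>Q. c i \<ge> 0) \<and> (\<Sum>i\<in>K \<union> Q. c i *\<^sub>R v k i) = (\<Sum>i\<in>F \<union> P. a k i *\<^sub>R v k i)"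
    if k: "k \<ge> N" for k
  proof -
    obtain e where "\<forall>i\<in>Q. e i = a k i"
        "(\<Sum>i\<in>K \<union> Q. e i *\<^sub>R v k i) = (\<Sum>i\<in>F \<union> M \<union> Q. a k i *\<^sub>R v k i)"
      using replace_free_part_by_basis[OF finFM finQ FPQ(2) K(1), of "v k" "a k"] N[OF k] by blast
    moreover have "\<forall>i\<in>Q. a k i \<ge> 0" using nonneg by (simp add: Q_def)
    ultimately show ?thesis unfolding FPQ(1) by (intro exI[of _ e]) simp
  qed
  then have "\<forall>k. \<exists>c. (\<forall>i\<in>Q. c i \<ge> 0) \<and>
      (\<Sum>i\<in>K \<union> Q. c i *\<^sub>R v (k + N) i) = (\<Sum>i\<in>F \<union> P. a (k + N) i *\<^sub>R v (k + N) i)" by simp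
  then obtain c where c: "\<And>k. \<forall>i\<in>Q. c k i \<ge> 0"
      "\<And>k. (\<Sum>i\<in>K \<union> Q. c k i *\<^sub>R v (k + N) i) = (\<Sum>i\<in>F \<union> P. a (k + N) i *\<^sub>R v (k + N) i)"
    by metis
  have sub: "K \<union> Q \<subseteq> F \<union> P" using K MP by (auto simp: Q_def)
  have wN: "(\<lambda>k. \<Sum>i\<in>K \<union> Q. c k i *\<^sub>R v (k + N) i) \<longlonglongrightarrow> w"
    using LIMSEQ_ignore_initial_segment[OF w, of N] c(2) by simp
  have vN: "(\<lambda>k. v (k + N) i) \<longlonglongrightarrow> vl i" if "i \<in> F \<union> P" for i
    using LIMSEQ_ignore_initial_segment[OF v[OF that], of N] .
  have "(\<exists>c. (\<forall>i\<in>Q. c i \<ge> 0) \<and> (\<Sum>i\<in>K \<union> Q. c i *\<^sub>R vl i) = w) \<or>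
    (\<exists>c. (\<forall>i\<in>Q. c i \<ge> 0) \<and> (\<exists>i\<in>K \<union> Q. c i \<noteq> 0) \<and> (\<Sum>i\<in>K \<union> Q. c i *\<^sub>R vl i) = 0)"
  proof (rule combination_limit_or_relation[OF _ _ wN])
    show "finite (K \<union> Q)" using finite_subset[OF sub finU] .
  qed (use vN sub c(1) in blast)+
  then consider c' where "\<forall>i\<in>Q. c' i \<ge> 0" "(\<Sum>i\<in>K \<union> Q. c' i *\<^sub>R vl i) = w"
    | c' where "\<forall>i\<in>Q. c' i \<ge> 0" "\<exists>i\<in>K \<union> Q. c' i \<noteq> 0" "(\<Sum>i\<in>K \<union> Q. c' i *\<^sub>R vl i) = 0"
    by blast
  then show ?thesis
  proof cases
    case 1
    have "c' i *\<^sub>R vl i \<in> C" if "i \<in> K \<union> Q" for i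
      using that 1 lin unit K(1) by (cases "i \<in> K") (auto simp: Q_def)
    then have "(\<Sum>i\<in>K \<union> Q. c' i *\<^sub>R vl i) \<in> C" by (rule sumC)
    then show ?thesis using 1(2) by simp
  next
    case 2
    \<comment> \<open>A positive coefficient over \<open>Q\<close> exhibits the negative of its vector as an element of \<open>C\<close>.\<close>
    have "\<forall>j\<in>Q. c' j = 0"
    proof (rule ccontr)
      assume "\<not> ?thesis"
      then obtain j where j: "j \<in> Q" "c' j > 0" using 2(1) by force
      have "c' j *\<^sub>R vl j + (\<Sum>i\<in>K \<union> Q - {j}. c' i *\<^sub>R vl i) = 0"
        using 2(3) sum.remove[of "K \<union> Q" j "\<lambda>i. c' i *\<^sub>R vl i"] j finK finQ by simp
      then have eq: "c' j *\<^sub>R (- vl j) = (\<Sum>i\<in>K \<union> Q - {j}. c' i *\<^sub>R vl i)"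
        by (simp add: minus_unique)
      have "c' i *\<^sub>R vl i \<in> C" if "i \<in> K \<union> Q" for i
        using that 2(1) lin unit K(1) by (cases "i \<in> K") (auto simp: Q_def)
      then have "c' j *\<^sub>R (- vl j) \<in> C" unfolding eq by (intro sumC) auto
      from scaleC[OF this, of "1 / c' j"] have "- vl j \<in> C" using j by simp
      then show False using j M by (auto simp: Q_def)
    qed
    moreover have "(\<Sum>i\<in>K \<union> Q. c' i *\<^sub>R vl i) = (\<Sum>i\<in>K. c' i *\<^sub>R vl i)"
      by (rule sum.mono_neutral_right) (use calculation finK finQ in auto)
    ultimately have "\<forall>i\<in>K. c' i = 0" using 2(3) K(2) unfolding indep_family_def by simp
    with \<open>\<forall>j\<in>Q. c' j = 0\<close> 2(2) show ?thesis by blast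
  qed
qed

section \<open>Gradients in a chart\<close>

lemma linear_functional_as_inner:
  fixes l :: "'v::euclidean_space \<Rightarrow> real"
  assumes "linear l"
  shows "(\<Sum>b\<in>Basis. l b *\<^sub>R b) \<bullet> x = l x"
proof -
  have "l x = l (\<Sum>b\<in>Basis. (x \<bullet> b) *\<^sub>R b)" by (simp add: euclidean_representation)
  also have "\<dots> = (\<Sum>b\<in>Basis. (x \<bullet> b) * l b)"
    using assms by (simp add: linear_sum linear_scale)
  also have "\<dots> = (\<Sum>b\<in>Basis. l b *\<^sub>R b) \<bullet> x"
    by (simp add: inner_sum_left inner_commute[of x] mult.commute)
  finally show ?thesis by simp
qed

locale riemannian_atlas =
  fixes A :: "('a::{second_countable_topology, t2_space}, 'e::euclidean_space) chart set"
    and G :: "('a, 'e) metric"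
  assumes atlas: "smooth_atlas A" and metric: "riemannian_metric A G"
begin

lemma chart_at_exists: "\<exists>\<phi>. \<phi> \<in> charts_at A p"
proof -
  have "p \<in> \<Union> (cdom ` A)" using atlas unfolding smooth_atlas_def by simp
  then show ?thesis unfolding charts_at_def by blast
qed

lemma chart_homeomorphism:
  assumes "\<phi> \<in> A"
  shows "open (cdom \<phi>)" "open (coord \<phi> ` cdom \<phi>)"
    "homeomorphism (cdom \<phi>) (coord \<phi> ` cdom \<phi>) (coord \<phi>) (param \<phi>)"
  using atlas assms unfolding smooth_atlas_def is_chart_def by auto

lemma param_coord: "\<phi> \<in> A \<Longrightarrow> q \<in> cdom \<phi> \<Longrightarrow> param \<phi> (coord \<phi> q) = q"
  using chart_homeomorphism(3) by (rule homeomorphism_apply1)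

lemma overlap_open:
  assumes "\<phi> \<in> A" "\<psi> \<in> A"
  shows "open (coord \<phi> ` (cdom \<phi> \<inter> cdom \<psi>))"
proof -
  have "open (coord \<phi> ` cdom \<phi> \<inter> param \<phi> -` cdom \<psi>)"
    using chart_homeomorphism[OF assms(1)] chart_homeomorphism(1)[OF assms(2)]
    by (intro continuous_open_preimage) (auto dest: homeomorphism_cont2)
  moreover have "coord \<phi> ` cdom \<phi> \<inter> param \<phi> -` cdom \<psi> = coord \<phi> ` (cdom \<phi> \<inter> cdom \<psi>)"
    using param_coord[OF assms(1)] by auto
  ultimately show ?thesis by simp
qed

lemma transition_Ck:
  assumes "\<phi> \<in> A" "\<psi> \<in> A"
  shows "Ck_on k (coord \<psi> \<circ> param \<phi>) (coord \<phi> ` (cdom \<phi> \<inter> cdom \<psi>))"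
  using atlas assms unfolding smooth_atlas_def smooth_on_def by blast

lemma transition_differentiable:
  assumes "\<phi> \<in> charts_at A q" "\<psi> \<in> charts_at A q"
  shows "(coord \<psi> \<circ> param \<phi>) differentiable (at (coord \<phi> q))"
  using transition_Ck[of \<phi> \<psi> "Suc 0"] assms unfolding charts_at_def by auto

definition differentiable_at_point :: "('a \<Rightarrow> real) \<Rightarrow> 'a \<Rightarrow> bool" where
  "differentiable_at_point F q \<longleftrightarrow> (\<forall>\<phi>\<in>charts_at A q. (F \<circ> param \<phi>) differentiable (at (coord \<phi> q)))"

text \<open>
  Applied to real functions, this shows that the differential does not depend on the chart; applied
  to coordinate maps, it is the cocycle identity behind the transformation rule of tangent vectors.
\<close>

lemma change_of_chart:
  fixes F :: "'a \<Rightarrow> 'b::real_normed_vector"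
  assumes \<phi>: "\<phi> \<in> charts_at A q" and \<psi>: "\<psi> \<in> charts_at A q"
    and F: "(F \<circ> param \<psi>) differentiable (at (coord \<psi> q))"
  shows "frechet_derivative (F \<circ> param \<phi>) (at (coord \<phi> q)) x =
    frechet_derivative (F \<circ> param \<psi>) (at (coord \<psi> q))
      (frechet_derivative (coord \<psi> \<circ> param \<phi>) (at (coord \<phi> q)) x)"
proof -
  let ?T = "frechet_derivative (coord \<psi> \<circ> param \<phi>) (at (coord \<phi> q))"
  let ?D = "frechet_derivative (F \<circ> param \<psi>) (at (coord \<psi> q))"
  have in_A: "\<phi> \<in> A" "\<psi> \<in> A" "q \<in> cdom \<phi>" "q \<in> cdom \<psi>"
    using \<phi> \<psi> by (auto simp: charts_at_def)
  have "((coord \<psi> \<circ> param \<phi>) has_derivative ?T) (at (coord \<phi> q))"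
    using transition_differentiable[OF \<phi> \<psi>] by (simp add: frechet_derivative_works)
  moreover have "((F \<circ> param \<psi>) has_derivative ?D) (at ((coord \<psi> \<circ> param \<phi>) (coord \<phi> q)))"
    using F in_A by (simp add: frechet_derivative_works param_coord)
  ultimately have "((F \<circ> param \<psi>) \<circ> (coord \<psi> \<circ> param \<phi>) has_derivative ?D \<circ> ?T) (at (coord \<phi> q))"
    by (rule diff_chain_at)
  then have "((F \<circ> param \<phi>) has_derivative ?D \<circ> ?T) (at (coord \<phi> q))"
  proof (rule has_derivative_transform_within_open)
    show "open (coord \<phi> ` (cdom \<phi> \<inter> cdom \<psi>))" using overlap_open in_A by blast
  qed (use in_A in \<open>auto simp: param_coord\<close>)
  then have "frechet_derivative (F \<circ> param \<phi>) (at (coord \<phi> q)) = ?D \<circ> ?T"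
    using frechet_derivative_at by metis
  then show ?thesis by simp
qed

lemma transition_derivative_same_chart:
  assumes "\<phi> \<in> charts_at A q"
  shows "frechet_derivative (coord \<phi> \<circ> param \<phi>) (at (coord \<phi> q)) x = x"
proof -
  have in_A: "\<phi> \<in> A" "q \<in> cdom \<phi>" using assms by (auto simp: charts_at_def)
  have "((coord \<phi> \<circ> param \<phi>) has_derivative (\<lambda>x. x)) (at (coord \<phi> q))"
    by (rule has_derivative_transform_within_open[OF has_derivative_ident chart_homeomorphism(2)[OF in_A(1)]])
      (use in_A in \<open>auto simp: param_coord\<close>)
  then have "(\<lambda>x. x) = frechet_derivative (coord \<phi> \<circ> param \<phi>) (at (coord \<phi> q))"
    by (rule frechet_derivative_at)
  then show ?thesis by metis
qed

lemma coord_vec_self: "\<phi> \<in> charts_at A q \<Longrightarrow> coord_vec A \<phi> q x \<phi> = x"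
  by (simp add: coord_vec_def transition_derivative_same_chart)

lemma coord_vec_tangent:
  assumes "\<phi> \<in> charts_at A q"
  shows "coord_vec A \<phi> q x \<in> tangent_space A q"
  unfolding tangent_space_def mem_Collect_eq
proof (intro conjI allI ballI impI)
  fix \<psi> \<theta> assume \<psi>: "\<psi> \<in> charts_at A q" and \<theta>: "\<theta> \<in> charts_at A q"
  show "coord_vec A \<phi> q x \<theta> =
      frechet_derivative (coord \<theta> \<circ> param \<psi>) (at (coord \<psi> q)) (coord_vec A \<phi> q x \<psi>)"
    using change_of_chart[OF assms \<psi> transition_differentiable[OF \<psi> \<theta>]] \<psi> \<theta>
    by (simp only: coord_vec_def if_True)
qed (simp only: coord_vec_def if_False)

lemma tangent_eq_coord_vec:
  assumes "\<phi> \<in> charts_at A q" "v \<in> tangent_space A q"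
  shows "v = coord_vec A \<phi> q (v \<phi>)"
proof
  fix \<psi>
  show "v \<psi> = coord_vec A \<phi> q (v \<phi>) \<psi>"
  proof (cases "\<psi> \<in> charts_at A q")
    case True
    then have "v \<psi> = frechet_derivative (coord \<psi> \<circ> param \<phi>) (at (coord \<phi> q)) (v \<phi>)"
      using assms unfolding tangent_space_def by blast
    with True show ?thesis by (simp only: coord_vec_def if_True)
  next
    case False
    then have "v \<psi> = 0" using assms(2) unfolding tangent_space_def by blast
    with False show ?thesis by (simp only: coord_vec_def if_False)
  qed
qed

lemma linear_coord_vec:
  assumes \<phi>: "\<phi> \<in> charts_at A q"
  shows "linear (coord_vec A \<phi> q)"
proof (rule linearI; rule ext)
  fix x y c \<psi>
  have lin: "linear (frechet_derivative (coord \<psi> \<circ> param \<phi>) (at (coord \<phi> q)))" if "\<psi> \<in> charts_at A q"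
    using transition_differentiable[OF \<phi> that] by (rule linear_frechet_derivative)
  show "coord_vec A \<phi> q (x + y) \<psi> = (coord_vec A \<phi> q x + coord_vec A \<phi> q y) \<psi>"
    using lin by (auto simp: coord_vec_def linear_add)
  show "coord_vec A \<phi> q (c *\<^sub>R x) \<psi> = (c *\<^sub>R coord_vec A \<phi> q x) \<psi>"
    using lin by (auto simp: coord_vec_def scaleR_fun_def linear_scale)
qed

lemma differential_in_chart:
  assumes \<phi>: "\<phi> \<in> charts_at A q" and v: "v \<in> tangent_space A q"
    and F: "differentiable_at_point F q"
  shows "differential A F q v = frechet_derivative (F \<circ> param \<phi>) (at (coord \<phi> q)) (v \<phi>)"
proof -
  define \<psi> where "\<psi> = (SOME \<psi>. \<psi> \<in> charts_at A q)"
  have \<psi>: "\<psi> \<in> charts_at A q" unfolding \<psi>_def using chart_at_exists by (rule someI_ex)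
  have "(F \<circ> param \<psi>) differentiable (at (coord \<psi> q))"
    using F \<psi> unfolding differentiable_at_point_def by blast
  note chain = change_of_chart[OF \<phi> \<psi> this]
  have v\<psi>: "v \<psi> = frechet_derivative (coord \<psi> \<circ> param \<phi>) (at (coord \<phi> q)) (v \<phi>)"
    using v \<phi> \<psi> unfolding tangent_space_def by blast
  have "differential A F q v = frechet_derivative (F \<circ> param \<psi>) (at (coord \<psi> q)) (v \<psi>)"
    unfolding differential_def Let_def \<psi>_def ..
  then show ?thesis by (simp only: v\<psi> chain)
qed

text \<open>
  The metric at \<open>q\<close> as a bilinear form on the model space.
\<close>

definition gram :: "('a, 'e) chart \<Rightarrow> 'a \<Rightarrow> 'e \<Rightarrow> 'e \<Rightarrow> real" where
  "gram \<phi> q x y = G q (coord_vec A \<phi> q x) (coord_vec A \<phi> q y)"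

lemma gram_properties:
  assumes \<phi>: "\<phi> \<in> charts_at A q"
  shows gram_sym: "gram \<phi> q x y = gram \<phi> q y x"
    and gram_add_left: "gram \<phi> q (x + x') y = gram \<phi> q x y + gram \<phi> q x' y"
    and gram_scale_left: "gram \<phi> q (c *\<^sub>R x) y = c * gram \<phi> q x y"
    and gram_pos: "x \<noteq> 0 \<Longrightarrow> gram \<phi> q x x > 0"
proof -
  note m = metric[unfolded riemannian_metric_def] coord_vec_tangent[OF \<phi>]
  show "gram \<phi> q x y = gram \<phi> q y x" using m unfolding gram_def by blast
  show "gram \<phi> q (x + x') y = gram \<phi> q x y + gram \<phi> q x' y"
    using m by (simp add: gram_def linear_add[OF linear_coord_vec[OF \<phi>]])
  show "gram \<phi> q (c *\<^sub>R x) y = c * gram \<phi> q x y"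
    using m by (simp add: gram_def linear_scale[OF linear_coord_vec[OF \<phi>]])
  assume "x \<noteq> 0"
  then have "coord_vec A \<phi> q x \<noteq> 0" using coord_vec_self[OF \<phi>, of x] by fastforce
  then show "gram \<phi> q x x > 0" using m unfolding gram_def by blast
qed

lemma linear_gram_left: "\<phi> \<in> charts_at A q \<Longrightarrow> linear (\<lambda>x. gram \<phi> q x y)"
  by (rule linearI) (simp_all add: gram_add_left gram_scale_left)

lemma linear_gram_right: "\<phi> \<in> charts_at A q \<Longrightarrow> linear (gram \<phi> q x)"
  using linear_gram_left[of \<phi> q x] gram_sym[of \<phi> q x] by presburger

lemma gram_nonneg: "\<phi> \<in> charts_at A q \<Longrightarrow> gram \<phi> q x x \<ge> 0"
  using gram_pos[of \<phi> q x] linear_0[OF linear_gram_left[of \<phi> q 0]]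
  by (cases "x = 0") (auto simp: less_imp_le)

lemma gram_Cauchy_Schwarz:
  assumes \<phi>: "\<phi> \<in> charts_at A q"
  shows "\<bar>gram \<phi> q x y\<bar> \<le> sqrt (gram \<phi> q x x) * sqrt (gram \<phi> q y y)"
proof (cases "y = 0")
  case True
  then show ?thesis using linear_0[OF linear_gram_right[OF \<phi>, of x]] linear_0[OF linear_gram_right[OF \<phi>, of 0]] by simp
next
  case False
  let ?g = "gram \<phi> q"
  have y: "?g y y > 0" using gram_pos[OF \<phi> False] .
  define t where "t = ?g x y / ?g y y"
  have "0 \<le> ?g (x - t *\<^sub>R y) (x - t *\<^sub>R y)" by (rule gram_nonneg[OF \<phi>])
  also have "\<dots> = ?g x x - t * ?g x y - t * (?g y x - t * ?g y y)"
    by (simp add: linear_diff[OF linear_gram_left[OF \<phi>]] linear_diff[OF linear_gram_right[OF \<phi>]]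
        linear_scale[OF linear_gram_left[OF \<phi>]] linear_scale[OF linear_gram_right[OF \<phi>]] algebra_simps)
  also have "\<dots> = ?g x x - (?g x y)\<^sup>2 / ?g y y"
    using y by (simp add: t_def gram_sym[OF \<phi>, of y x] power2_eq_square)
  finally have "(?g x y)\<^sup>2 \<le> ?g x x * ?g y y" using y by (simp add: field_simps)
  then have "sqrt ((?g x y)\<^sup>2) \<le> sqrt (?g x x * ?g y y)" by (rule real_sqrt_le_mono)
  then show ?thesis by (simp add: real_sqrt_mult)
qed

text \<open>
  The differential of \<open>F\<close> at \<open>q\<close> in the chart \<open>\<phi>\<close>, as the vector that represents it by the inner
  product of the model space; it depends on \<open>q\<close> more simply than the gradient, whose coordinates
  involve the inverse of the metric.
\<close>

definition covector :: "('a, 'e) chart \<Rightarrow> ('a \<Rightarrow> real) \<Rightarrow> 'a \<Rightarrow> 'e" where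
  "covector \<phi> F q = (\<Sum>b\<in>Basis. frechet_derivative (F \<circ> param \<phi>) (at (coord \<phi> q)) b *\<^sub>R b)"

text \<open>
  The map \<open>S\<close> raises the index: it is the inverse of lowering the index by the metric, which is
  injective by positive definiteness and hence bijective in finite dimension.
\<close>

lemma gradient_from_covector:
  assumes \<phi>: "\<phi> \<in> charts_at A q"
  shows "\<exists>S. linear S \<and> inj S \<and> range S \<subseteq> tangent_space A q \<and>
    (\<forall>F. differentiable_at_point F q \<longrightarrow> grad A G F q = S (covector \<phi> F q)) \<and>
    (\<forall>c x. gram \<phi> q (S c \<phi>) x = c \<bullet> x)"
proof -
  let ?g = "gram \<phi> q" and ?cv = "coord_vec A \<phi> q"
  define T where "T x = (\<Sum>b\<in>Basis. ?g x b *\<^sub>R b)" for x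
  have T: "T x \<bullet> y = ?g x y" for x y
    unfolding T_def by (rule linear_functional_as_inner[OF linear_gram_right[OF \<phi>]])
  have linT: "linear T"
    by (rule linearI) (simp_all add: T_def gram_add_left[OF \<phi>] gram_scale_left[OF \<phi>] sum.distrib scaleR_add_left scaleR_sum_right)
  have injT: "inj T"
  proof (subst linear_injective_0[OF linT], intro allI impI)
    fix x assume "T x = 0"
    then have "?g x x = 0" using T[of x x] by simp
    then show "x = 0" using gram_pos[OF \<phi>, of x] by fastforce
  qed
  obtain T' where T': "linear T'" "\<And>x. T' (T x) = x" "\<And>x. T (T' x) = x"
    using linear_injective_isomorphism[OF linT injT] by blast
  define S where "S = ?cv \<circ> T'"
  have S\<phi>: "S c \<phi> = T' c" for c by (simp add: S_def coord_vec_self[OF \<phi>])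
  have gS: "?g (S c \<phi>) x = c \<bullet> x" for c x using T[of "T' c" x] T' S\<phi> by simp
  have Stan: "S c \<in> tangent_space A q" for c by (simp add: S_def coord_vec_tangent[OF \<phi>])
  have "linear S" unfolding S_def using T'(1) linear_coord_vec[OF \<phi>] by (rule linear_compose)
  moreover have "inj S" using S\<phi> T'(3) by (metis injI)
  moreover have "grad A G F q = S (covector \<phi> F q)" if F: "differentiable_at_point F q" for F
  proof -
    let ?D = "frechet_derivative (F \<circ> param \<phi>) (at (coord \<phi> q))"
    have "(F \<circ> param \<phi>) differentiable (at (coord \<phi> q))"
      using F \<phi> unfolding differentiable_at_point_def by blast
    then have cov: "covector \<phi> F q \<bullet> x = ?D x" for x
      unfolding covector_def by (intro linear_functional_as_inner linear_frechet_derivative)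
    have G_gram: "G q v w = ?g (v \<phi>) (w \<phi>)" if "v \<in> tangent_space A q" "w \<in> tangent_space A q" for v w
      unfolding gram_def using tangent_eq_coord_vec[OF \<phi>] that by metis
    show ?thesis
      unfolding grad_def
    proof (rule the_equality)
      show "S (covector \<phi> F q) \<in> tangent_space A q \<and>
          (\<forall>w\<in>tangent_space A q. G q (S (covector \<phi> F q)) w = differential A F q w)"
        using Stan F \<phi> by (auto simp: G_gram gS cov differential_in_chart)
    next
      fix v assume v: "v \<in> tangent_space A q \<and> (\<forall>w\<in>tangent_space A q. G q v w = differential A F q w)"
      have "T (v \<phi>) \<bullet> x = covector \<phi> F q \<bullet> x" for x
      proof -
        have "T (v \<phi>) \<bullet> x = G q v (?cv x)"
          using v G_gram[of v "?cv x"] coord_vec_tangent[OF \<phi>] coord_vec_self[OF \<phi>] by (simp add: T)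
        also have "\<dots> = ?D x"
          using v coord_vec_tangent[OF \<phi>] differential_in_chart[OF \<phi> _ F] coord_vec_self[OF \<phi>] by simp
        finally show ?thesis using cov by simp
      qed
      then have "T (v \<phi>) = covector \<phi> F q" using vector_eq_rdot by blast
      then have "v \<phi> = T' (covector \<phi> F q)" using T'(2) by metis
      then show "v = S (covector \<phi> F q)" using tangent_eq_coord_vec[OF \<phi>] v by (metis S_def comp_apply)
    qed
  qed
  ultimately show ?thesis using gS Stan by blast
qed

text \<open>
  The covector pairs with \<open>x\<close> as the gradient does under the metric, so this is the Cauchy--Schwarz
  inequality.
\<close>

lemma covector_bound:
  assumes \<phi>: "\<phi> \<in> charts_at A q" and F: "differentiable_at_point F q"
  shows "\<bar>covector \<phi> F q \<bullet> x\<bar> \<le> tnorm G q (grad A G F q) * sqrt (gram \<phi> q x x)"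
proof -
  obtain S where S: "range S \<subseteq> tangent_space A q" "grad A G F q = S (covector \<phi> F q)"
      "\<And>c x. gram \<phi> q (S c \<phi>) x = c \<bullet> x"
    using gradient_from_covector[OF \<phi>] F by blast
  let ?v = "grad A G F q"
  have v: "?v \<in> tangent_space A q" using S by auto
  have "tnorm G q ?v = sqrt (gram \<phi> q (?v \<phi>) (?v \<phi>))"
    unfolding tnorm_def gram_def using tangent_eq_coord_vec[OF \<phi> v] by simp
  then show ?thesis using gram_Cauchy_Schwarz[OF \<phi>, of "?v \<phi>" x] S(2,3) by simp
qed

lemma C1_map_differentiable: "C1_map A F \<Longrightarrow> differentiable_at_point F q"
  unfolding C1_map_def differentiable_at_point_def charts_at_def by auto

lemma coord_tendsto:
  fixes H :: "'e \<Rightarrow> 'b::topological_space"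
  assumes \<phi>: "\<phi> \<in> charts_at A p" and x: "x \<longlonglongrightarrow> p"
    and H: "continuous_on (coord \<phi> ` cdom \<phi>) H"
  shows "(\<lambda>k. H (coord \<phi> (x k))) \<longlonglongrightarrow> H (coord \<phi> p)"
proof -
  have \<phi>': "\<phi> \<in> A" "p \<in> cdom \<phi>" using \<phi> by (auto simp: charts_at_def)
  have "continuous_on (cdom \<phi>) (H \<circ> coord \<phi>)"
    using H homeomorphism_cont1[OF chart_homeomorphism(3)[OF \<phi>'(1)]] by (intro continuous_on_compose)
  then have "isCont (H \<circ> coord \<phi>) p"
    using chart_homeomorphism(1)[OF \<phi>'(1)] \<phi>'(2) continuous_on_eq_continuous_at by blast
  then show ?thesis using isCont_tendsto_compose[OF _ x, of "H \<circ> coord \<phi>"] by simp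
qed

lemma eventually_in_chart:
  assumes \<phi>: "\<phi> \<in> charts_at A p" and x: "x \<longlonglongrightarrow> p"
  shows "\<forall>\<^sub>F k in sequentially. \<phi> \<in> charts_at A (x k)"
proof -
  have \<phi>': "\<phi> \<in> A" "p \<in> cdom \<phi>" using \<phi> by (auto simp: charts_at_def)
  have "\<forall>\<^sub>F k in sequentially. x k \<in> cdom \<phi>"
    using topological_tendstoD[OF x chart_homeomorphism(1)[OF \<phi>'(1)] \<phi>'(2)] .
  then show ?thesis using \<phi>' by (simp add: charts_at_def)
qed

lemma C1_map_tendsto:
  assumes x: "x \<longlonglongrightarrow> p" and F: "C1_map A F"
  shows "(\<lambda>k. F (x k)) \<longlonglongrightarrow> F p"
proof -
  obtain \<phi> where \<phi>: "\<phi> \<in> charts_at A p" using chart_at_exists by blast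
  then have \<phi>': "\<phi> \<in> A" "p \<in> cdom \<phi>" by (auto simp: charts_at_def)
  have "\<forall>z\<in>coord \<phi> ` cdom \<phi>. (F \<circ> param \<phi>) differentiable (at z)"
    using F \<phi>' unfolding C1_map_def by simp
  then have "continuous_on (coord \<phi> ` cdom \<phi>) (F \<circ> param \<phi>)"
    using differentiable_imp_continuous_within by (blast intro: continuous_at_imp_continuous_on)
  then have "(\<lambda>k. (F \<circ> param \<phi>) (coord \<phi> (x k))) \<longlonglongrightarrow> (F \<circ> param \<phi>) (coord \<phi> p)"
    by (rule coord_tendsto[OF \<phi> x])
  moreover have "\<forall>\<^sub>F k in sequentially. (F \<circ> param \<phi>) (coord \<phi> (x k)) = F (x k)"
    using eventually_in_chart[OF \<phi> x] by eventually_elim (simp add: charts_at_def param_coord)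
  ultimately show ?thesis using \<phi>' by (simp add: param_coord tendsto_cong)
qed

lemma covector_tendsto:
  assumes \<phi>: "\<phi> \<in> charts_at A p" and x: "x \<longlonglongrightarrow> p" and F: "C1_map A F"
  shows "(\<lambda>k. covector \<phi> F (x k)) \<longlonglongrightarrow> covector \<phi> F p"
proof -
  have "\<phi> \<in> A" using \<phi> by (auto simp: charts_at_def)
  then have "continuous_on (coord \<phi> ` cdom \<phi>) (\<lambda>z. frechet_derivative (F \<circ> param \<phi>) (at z) b)" for b
    using F unfolding C1_map_def by simp
  then have "(\<lambda>k. frechet_derivative (F \<circ> param \<phi>) (at (coord \<phi> (x k))) b)
      \<longlonglongrightarrow> frechet_derivative (F \<circ> param \<phi>) (at (coord \<phi> p)) b" for b
    using coord_tendsto[OF \<phi> x] by fast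
  then show ?thesis unfolding covector_def by (intro tendsto_sum tendsto_scaleR tendsto_const)
qed

lemma gram_continuous:
  assumes "\<phi> \<in> A"
  shows "continuous_on (coord \<phi> ` cdom \<phi>) (\<lambda>z. gram \<phi> (param \<phi> z) x y)"
proof -
  have "Ck_on 0 (\<lambda>z. gram \<phi> (param \<phi> z) x y) (coord \<phi> ` cdom \<phi>)"
    using metric assms unfolding riemannian_metric_def smooth_on_def gram_def by blast
  then show ?thesis by simp
qed

lemma gram_tendsto:
  assumes \<phi>: "\<phi> \<in> charts_at A p" and x: "x \<longlonglongrightarrow> p"
  shows "(\<lambda>k. gram \<phi> (x k) y z) \<longlonglongrightarrow> gram \<phi> p y z"
proof -
  have \<phi>': "\<phi> \<in> A" "p \<in> cdom \<phi>" using \<phi> by (auto simp: charts_at_def)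
  have "(\<lambda>k. gram \<phi> (param \<phi> (coord \<phi> (x k))) y z) \<longlonglongrightarrow> gram \<phi> (param \<phi> (coord \<phi> p)) y z"
    by (rule coord_tendsto[OF \<phi> x gram_continuous[OF \<phi>'(1)]])
  moreover have "\<forall>\<^sub>F k in sequentially. gram \<phi> (param \<phi> (coord \<phi> (x k))) y z = gram \<phi> (x k) y z"
    using eventually_in_chart[OF \<phi> x] by eventually_elim (simp add: charts_at_def param_coord)
  ultimately show ?thesis using \<phi>' by (simp add: param_coord tendsto_cong)
qed

text \<open>
  The functions may vary with \<open>k\<close>, as the augmented Lagrangians do. The bound compares the Riemannian norm with
  the norm of the model space by the Gram coefficients, which converge along the sequence.
\<close>

lemma covector_vanishes:
  assumes \<phi>: "\<phi> \<in> charts_at A p" and x: "x \<longlonglongrightarrow> p"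
    and F: "\<And>k. differentiable_at_point (F k) (x k)"
    and small: "\<And>k. tnorm G (x k) (grad A G (F k) (x k)) \<le> \<epsilon> k" and \<epsilon>: "\<epsilon> \<longlonglongrightarrow> 0"
  shows "(\<lambda>k. covector \<phi> (F k) (x k)) \<longlonglongrightarrow> 0"
proof -
  have "(\<lambda>k. covector \<phi> (F k) (x k) \<bullet> b) \<longlonglongrightarrow> 0" for b
  proof (rule Lim_null_comparison)
    show "\<forall>\<^sub>F k in sequentially. norm (covector \<phi> (F k) (x k) \<bullet> b) \<le> \<epsilon> k * sqrt (gram \<phi> (x k) b b)"
      using eventually_in_chart[OF \<phi> x]
    proof eventually_elim
      case (elim k)
      have "\<bar>covector \<phi> (F k) (x k) \<bullet> b\<bar> \<le> tnorm G (x k) (grad A G (F k) (x k)) * sqrt (gram \<phi> (x k) b b)"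
        by (rule covector_bound[OF elim F])
      also have "\<dots> \<le> \<epsilon> k * sqrt (gram \<phi> (x k) b b)"
        using gram_nonneg[OF elim] by (intro mult_right_mono small) auto
      finally show ?case by simp
    qed
    show "(\<lambda>k. \<epsilon> k * sqrt (gram \<phi> (x k) b b)) \<longlonglongrightarrow> 0"
      using tendsto_mult[OF \<epsilon> tendsto_real_sqrt[OF gram_tendsto[OF \<phi> x, of b b]]] by simp
  qed
  then have "(\<lambda>k. \<Sum>b\<in>Basis. (covector \<phi> (F k) (x k) \<bullet> b) *\<^sub>R b) \<longlonglongrightarrow> (\<Sum>b\<in>Basis. 0 *\<^sub>R b)"
    by (intro tendsto_sum tendsto_scaleR tendsto_const)
  then show ?thesis by (simp add: euclidean_representation)
qed

end

section \<open>Riemannian balls are neighbourhoods\<close>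

text \<open>
  If \<open>f\<close> is not integrable, its integral is zero by convention, whence the condition \<open>K \<ge> 0\<close>.
\<close>

lemma integral_unit_interval_le:
  fixes f :: "real \<Rightarrow> real"
  assumes "\<And>t. t \<in> {0..1} \<Longrightarrow> f t \<le> K" "K \<ge> 0"
  shows "integral {0..1} f \<le> K"
proof (cases "f integrable_on {0..1}")
  case True
  then have "integral {0..1} f \<le> integral {0..1} (\<lambda>_::real. K)"
    using assms by (intro integral_le) auto
  then show ?thesis by simp
next
  case False
  then show ?thesis using assms by (simp add: not_integrable_integral)
qed

context riemannian_atlas
begin

text \<open>
  A crude bound whose constant is visibly continuous in the base point, so that it is locally
  uniform.
\<close>

lemma gram_upper_bound:
  assumes \<phi>: "\<phi> \<in> charts_at A q"
  shows "gram \<phi> q x x \<le> (\<Sum>b\<in>Basis. \<Sum>b'\<in>Basis. \<bar>gram \<phi> q b b'\<bar>) * (norm x)\<^sup>2"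
proof -
  let ?g = "gram \<phi> q"
  have right: "?g y x = (\<Sum>b'\<in>Basis. (x \<bullet> b') * ?g y b')" for y
  proof -
    have "?g y x = ?g y (\<Sum>b'\<in>Basis. (x \<bullet> b') *\<^sub>R b')" by (simp add: euclidean_representation)
    then show ?thesis
      by (simp add: linear_sum[OF linear_gram_right[OF \<phi>]] linear_scale[OF linear_gram_right[OF \<phi>]])
  qed
  have "?g x x = (\<Sum>b\<in>Basis. (x \<bullet> b) * ?g x b)" by (rule right)
  also have "\<dots> = (\<Sum>b\<in>Basis. (x \<bullet> b) * ?g b x)"
    by (intro sum.cong refl arg_cong2[where f = times] gram_sym[OF \<phi>])
  also have "\<dots> = (\<Sum>b\<in>Basis. \<Sum>b'\<in>Basis. (x \<bullet> b) * (x \<bullet> b') * ?g b b')"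
    by (simp add: right sum_distrib_left mult.assoc)
  also have "\<dots> \<le> (\<Sum>b\<in>Basis. \<Sum>b'\<in>Basis. \<bar>?g b b'\<bar> * (norm x)\<^sup>2)"
  proof (intro sum_mono)
    fix b b' :: 'e assume b: "b \<in> Basis" "b' \<in> Basis"
    have "\<bar>x \<bullet> b\<bar> * \<bar>x \<bullet> b'\<bar> \<le> norm x * norm x"
      using b by (intro mult_mono Basis_le_norm) auto
    then have "\<bar>x \<bullet> b\<bar> * \<bar>x \<bullet> b'\<bar> * \<bar>?g b b'\<bar> \<le> (norm x * norm x) * \<bar>?g b b'\<bar>"
      by (rule mult_right_mono) simp
    then have "\<bar>(x \<bullet> b) * (x \<bullet> b') * ?g b b'\<bar> \<le> \<bar>?g b b'\<bar> * (norm x)\<^sup>2"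
      by (simp add: abs_mult power2_eq_square mult.commute)
    then show "(x \<bullet> b) * (x \<bullet> b') * ?g b b' \<le> \<bar>?g b b'\<bar> * (norm x)\<^sup>2" by linarith
  qed
  finally show ?thesis by (simp add: sum_distrib_right)
qed

text \<open>
  A point near \<open>p\<close> is joined to \<open>p\<close> by a straight segment in a chart, whose Riemannian length is at
  most a constant times its Euclidean length.
\<close>

lemma riem_ball_contains_neighbourhood:
  assumes \<epsilon>: "\<epsilon> > 0"
  shows "\<exists>U. open U \<and> p \<in> U \<and> U \<subseteq> riem_ball A G p \<epsilon>"
proof -
  obtain \<phi> where \<phi>: "\<phi> \<in> charts_at A p" using chart_at_exists by blast
  then have \<phi>A: "\<phi> \<in> A" and p\<phi>: "p \<in> cdom \<phi>" by (auto simp: charts_at_def)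
  let ?Z = "coord \<phi> ` cdom \<phi>"
  define z0 where "z0 = coord \<phi> p"
  define B where "B z = (\<Sum>b\<in>Basis. \<Sum>b'\<in>Basis. \<bar>gram \<phi> (param \<phi> z) b b'\<bar>)" for z
  have B: "continuous_on ?Z B"
    unfolding B_def by (intro continuous_on_sum continuous_on_rabs gram_continuous \<phi>A)
  define C where "C = B z0 + 1"
  have C: "C > 0" unfolding C_def B_def by (intro add_nonneg_pos sum_nonneg) auto
  have "open (?Z \<inter> B -` {..<C})"
    by (intro continuous_open_preimage B chart_homeomorphism(2) \<phi>A open_lessThan)
  moreover have "z0 \<in> ?Z \<inter> B -` {..<C}" using p\<phi> by (auto simp: z0_def C_def)
  ultimately obtain r where r: "r > 0" "ball z0 r \<subseteq> ?Z \<inter> B -` {..<C}"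
    using open_contains_ball by blast
  \<comment> \<open>On the ball of radius \<open>r\<close> the metric is bounded by \<open>C\<close>, so speeds grow at most by \<open>sqrt C\<close>.\<close>
  define \<delta> where "\<delta> = min r (\<epsilon> / sqrt C)"
  have \<delta>: "\<delta> > 0" "\<delta> \<le> r" "sqrt C * \<delta> \<le> \<epsilon>"
    using r \<epsilon> C by (auto simp: \<delta>_def min_def field_simps)
  define U where "U = cdom \<phi> \<inter> coord \<phi> -` ball z0 \<delta>"
  have "open U"
    unfolding U_def using chart_homeomorphism[OF \<phi>A]
    by (intro continuous_open_preimage) (auto dest: homeomorphism_cont1)
  moreover have "p \<in> U" using p\<phi> \<delta> by (simp add: U_def z0_def)
  moreover have "U \<subseteq> riem_ball A G p \<epsilon>"
  proof
    fix q assume q: "q \<in> U"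
    define u where "u = coord \<phi> q - z0"
    have u: "norm u < \<delta>" using q by (auto simp: U_def u_def dist_norm norm_minus_commute)
    define l where "l t = z0 + t *\<^sub>R u" for t :: real
    have lball: "l t \<in> ball z0 r" if "t \<in> {0..1}" for t
    proof -
      have "norm (t *\<^sub>R u) \<le> norm u" using that by (simp add: mult_left_le_one_le)
      then show ?thesis using u \<delta> by (simp add: l_def dist_norm)
    qed
    define c where "c t = param \<phi> (l t)" for t
    have ZD: "param \<phi> z \<in> cdom \<phi>" "coord \<phi> (param \<phi> z) = z" if "z \<in> ?Z" for z
      using that param_coord[OF \<phi>A] by auto
    have c\<phi>: "c t \<in> cdom \<phi>" "coord \<phi> (c t) = l t" if "t \<in> {0..1}" for t
      unfolding c_def using ZD lball[OF that] r(2) by blast+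
    have c0: "c 0 = p" using param_coord[OF \<phi>A p\<phi>] by (simp add: c_def l_def z0_def)
    have c1: "c 1 = q" using q param_coord[OF \<phi>A] by (simp add: c_def l_def u_def U_def)
    let ?D = "\<lambda>\<psi> t. frechet_derivative (coord \<psi> \<circ> param \<phi>) (at (l t)) u"
    \<comment> \<open>The segment extends beyond its endpoints inside the chart, so two-sided derivatives exist there too.\<close>
    have deriv: "((coord \<psi> \<circ> c) has_vector_derivative ?D \<psi> t) (at t)"
      if "t \<in> {0..1}" "\<psi> \<in> A" "c t \<in> cdom \<psi>" for t \<psi>
    proof -
      have ch: "\<phi> \<in> charts_at A (c t)" "\<psi> \<in> charts_at A (c t)"
        using that c\<phi> \<phi>A by (auto simp: charts_at_def)
      have "((coord \<psi> \<circ> param \<phi>) has_derivative frechet_derivative (coord \<psi> \<circ> param \<phi>) (at (l t))) (at (l t))"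
        using transition_differentiable[OF ch] c\<phi>[OF that(1)] by (simp add: frechet_derivative_works)
      moreover have "(l has_vector_derivative u) (at t)"
        unfolding l_def by (auto intro!: derivative_eq_intros simp: has_vector_derivative_def)
      ultimately have "((coord \<psi> \<circ> param \<phi>) \<circ> l has_vector_derivative ?D \<psi> t) (at t)"
        using vector_derivative_diff_chain_within[of l u t UNIV "coord \<psi> \<circ> param \<phi>"]
        by (simp add: has_derivative_at_withinI)
      then show ?thesis by (simp add: c_def o_def)
    qed
    have contl: "continuous_on S l" for S unfolding l_def by (intro continuous_intros)
    have "C1_curve_on A 0 1 c"
      unfolding C1_curve_on_def
    proof (intro conjI ballI)
      have "l ` {0..1} \<subseteq> ?Z" using lball r(2) by blast
      then have "continuous_on (l ` {0..1}) (param \<phi>)"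
        using homeomorphism_cont2[OF chart_homeomorphism(3)[OF \<phi>A]] continuous_on_subset by blast
      then show "continuous_on {0..1} c"
        unfolding c_def using continuous_on_compose2[OF _ contl] by blast
    next
      fix \<psi> assume \<psi>: "\<psi> \<in> A"
      let ?T = "{t \<in> {0..1}. c t \<in> cdom \<psi>}"
      have "continuous_on (coord \<phi> ` (cdom \<phi> \<inter> cdom \<psi>)) (\<lambda>z. frechet_derivative (coord \<psi> \<circ> param \<phi>) (at z) u)"
        using transition_Ck[OF \<phi>A \<psi>, of "Suc 0"] by simp
      moreover have "l ` ?T \<subseteq> coord \<phi> ` (cdom \<phi> \<inter> cdom \<psi>)"
      proof
        fix z assume "z \<in> l ` ?T"
        then obtain t where "t \<in> {0..1}" "c t \<in> cdom \<psi>" "z = l t" by blast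
        then show "z \<in> coord \<phi> ` (cdom \<phi> \<inter> cdom \<psi>)" using c\<phi>[of t] by (metis IntI imageI)
      qed
      ultimately have "continuous_on ?T (?D \<psi>)" using continuous_on_compose2[OF _ contl] by blast
      then show "\<exists>D. continuous_on ?T D \<and> (\<forall>t\<in>{0..1}. c t \<in> cdom \<psi> \<longrightarrow>
          (coord \<psi> \<circ> c has_vector_derivative D t) (at t within {0..1}))"
        using deriv[OF _ \<psi>] has_vector_derivative_at_within by blast
    qed
    then have pw: "piecewise_C1_curve A c"
      unfolding piecewise_C1_curve_def by (intro exI[of _ "1::nat"] exI[of _ real]) simp
    have "tnorm G (c t) (velocity A c t) \<le> sqrt C * norm u" if t: "t \<in> {0..1}" for t
    proof -
      have ch: "\<phi> \<in> charts_at A (c t)" using t c\<phi> \<phi>A by (auto simp: charts_at_def)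
      have "velocity A c t = coord_vec A \<phi> (c t) u"
        using deriv[OF t] c\<phi>(2)[OF t] unfolding velocity_def coord_vec_def charts_at_def
        by (auto simp: fun_eq_iff intro: vector_derivative_at)
      then have "tnorm G (c t) (velocity A c t) = sqrt (gram \<phi> (c t) u u)"
        by (simp add: tnorm_def gram_def)
      also have "\<dots> \<le> sqrt (B (l t) * (norm u)\<^sup>2)"
        using gram_upper_bound[OF ch, of u] by (simp add: B_def c_def)
      also have "\<dots> \<le> sqrt (C * (norm u)\<^sup>2)"
        using lball[OF t] r(2) by (intro real_sqrt_le_mono mult_right_mono) (auto simp: less_imp_le)
      also have "\<dots> = sqrt C * norm u" by (simp add: real_sqrt_mult)
      finally show ?thesis .
    qed
    then have "curve_length A G c \<le> sqrt C * norm u"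
      unfolding curve_length_def using C by (intro integral_unit_interval_le) auto
    also have "\<dots> < \<epsilon>" using u C \<delta>(3) by (smt (verit) mult_less_cancel_left_pos real_sqrt_gt_zero)
    finally have "ereal (curve_length A G c) < ereal \<epsilon>" by simp
    moreover have "riem_dist A G p q \<le> ereal (curve_length A G c)"
      unfolding riem_dist_def by (rule INF_lower) (use pw c0 c1 in auto)
    ultimately have "riem_dist A G p q < ereal \<epsilon>" by (rule le_less_trans[rotated])
    then show "q \<in> riem_ball A G p \<epsilon>" unfolding riem_ball_def by simp
  qed
  ultimately show ?thesis by blast
qed

end

section \<open>Multipliers produced by the algorithm\<close>

text \<open>
  The square of the positive part is continuously differentiable, the kink at zero being
  flattened; this makes the augmented Lagrangian differentiable.
\<close>

lemma pos_part_square_has_derivative: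
  "((\<lambda>x::real. (max 0 x)\<^sup>2) has_real_derivative 2 * max 0 x) (at x)"
proof -
  consider "x > 0" | "x < 0" | "x = 0" by linarith
  then show ?thesis
  proof cases
    case 1
    have "((\<lambda>x::real. x\<^sup>2) has_real_derivative 2 * max 0 x) (at x)"
      using 1 by (auto intro!: derivative_eq_intros)
    then show ?thesis
      by (rule has_field_derivative_transform_within_open[where S = "{0<..}"]) (use 1 in auto)
  next
    case 2
    have "((\<lambda>x::real. 0) has_real_derivative 2 * max 0 x) (at x)"
      using 2 by (auto intro!: derivative_eq_intros)
    then show ?thesis
      by (rule has_field_derivative_transform_within_open[where S = "{..<0}"]) (use 2 in auto)
  next
    case 3
    have "(\<lambda>y::real. (max 0 y)\<^sup>2 / y) \<midarrow>0\<rightarrow> 0"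
    proof (rule Lim_null_comparison)
      show "\<forall>\<^sub>F y in at 0. norm ((max 0 y)\<^sup>2 / y) \<le> \<bar>y::real\<bar>"
        by (rule always_eventually) (auto simp: max_def power2_eq_square)
      show "(\<lambda>y::real. \<bar>y\<bar>) \<midarrow>0\<rightarrow> 0" by (rule tendsto_rabs_zero[OF tendsto_ident_at])
    qed
    then show ?thesis using 3 by (simp add: DERIV_def)
  qed
qed

lemma abs_le_L2_set:
  assumes "finite I" "i \<in> I"
  shows "\<bar>f i\<bar> \<le> L2_set f I"
proof -
  have "(f i)\<^sup>2 \<le> (\<Sum>i\<in>I. (f i)\<^sup>2)" using assms by (intro member_le_sum) auto
  then have "sqrt ((f i)\<^sup>2) \<le> sqrt (\<Sum>i\<in>I. (f i)\<^sup>2)" by (rule real_sqrt_le_mono)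
  then show ?thesis by (simp add: L2_set_def)
qed

text \<open>
  The penalty parameters never decrease. If they are bounded they converge, so their increments tend to
  zero; but each failed test increases them by at least \<open>(\<gamma> - 1) * \<rho> 1\<close>. Hence the test succeeds
  from some index on, and the measure \<open>M\<close> decays geometrically.
\<close>

lemma penalty_dichotomy:
  fixes \<rho> M :: "nat \<Rightarrow> real"
  assumes \<rho>1: "\<rho> 1 > 0" and \<gamma>: "\<gamma> > 1" and \<tau>: "0 \<le> \<tau>" "\<tau> < 1"
    and M: "\<And>k. M k \<ge> 0"
    and update: "\<forall>k\<ge>1. \<rho> (k + 1) = (if k = 1 \<or> M k \<le> \<tau> * M (k - 1) then \<rho> k else \<gamma> * \<rho> k)"
  shows "\<And>k. k \<ge> 1 \<Longrightarrow> \<rho> k \<ge> \<rho> 1"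
    and "filterlim \<rho> at_top sequentially \<or> (\<exists>B. (\<forall>k\<ge>1. \<rho> k \<le> B) \<and> M \<longlonglongrightarrow> 0)"
proof -
  note step = update[rule_format]
  have pos: "\<rho> (Suc k) > 0 \<and> \<rho> (Suc k) \<le> \<rho> (Suc (Suc k))" for k
  proof (induction k)
    case 0 show ?case using \<rho>1 step[of 1] by simp
  next
    case (Suc k)
    then have "\<rho> (Suc (Suc k)) > 0" by linarith
    then show ?case using step[of "Suc (Suc k)"] \<gamma> by simp
  qed
  have inc: "incseq (\<lambda>k. \<rho> (Suc k))" using pos by (simp add: incseq_Suc_iff)
  show ge: "\<rho> k \<ge> \<rho> 1" if "k \<ge> 1" for k
    using incseqD[OF inc, of 0 "k - 1"] that by simp
  show "filterlim \<rho> at_top sequentially \<or> (\<exists>B. (\<forall>k\<ge>1. \<rho> k \<le> B) \<and> M \<longlonglongrightarrow> 0)"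
  proof (cases "\<exists>B. \<forall>k. \<rho> (Suc k) \<le> B")
    case False
    have "filterlim (\<lambda>k. \<rho> (Suc k)) at_top sequentially"
      unfolding filterlim_at_top
    proof
      fix Z
      obtain k where "\<rho> (Suc k) > Z" using False by (meson not_le)
      then have "\<forall>n\<ge>k. Z \<le> \<rho> (Suc n)" using incseqD[OF inc] by (meson less_le_trans less_imp_le)
      then show "\<forall>\<^sub>F n in sequentially. Z \<le> \<rho> (Suc n)" unfolding eventually_sequentially by blast
    qed
    then show ?thesis by (simp add: filterlim_sequentially_Suc)
  next
    case True
    then obtain B where B: "\<And>k. \<rho> (Suc k) \<le> B" by blast
    obtain L where L: "(\<lambda>k. \<rho> (Suc k)) \<longlonglongrightarrow> L"
      using incseq_convergent[OF inc] B by blast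
    have "(\<lambda>k. \<rho> (Suc (Suc k)) - \<rho> (Suc k)) \<longlonglongrightarrow> 0"
      using tendsto_diff[OF LIMSEQ_Suc[OF L] L] by simp
    moreover have "0 < (\<gamma> - 1) * \<rho> 1" using \<gamma> \<rho>1 by simp
    ultimately have "\<forall>\<^sub>F k in sequentially. \<rho> (Suc (Suc k)) - \<rho> (Suc k) < (\<gamma> - 1) * \<rho> 1"
      by (rule order_tendstoD(2))
    then obtain N where N: "\<And>k. k \<ge> N \<Longrightarrow> \<rho> (Suc (Suc k)) - \<rho> (Suc k) < (\<gamma> - 1) * \<rho> 1"
      unfolding eventually_sequentially by blast
    have dec: "M (Suc k) \<le> \<tau> * M k" if k: "k \<ge> Suc N" for k
    proof (rule ccontr)
      assume "\<not> ?thesis"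
      then have "\<rho> (Suc (Suc k)) = \<gamma> * \<rho> (Suc k)" using step[of "Suc k"] k by simp
      then have "\<rho> (Suc (Suc k)) - \<rho> (Suc k) = (\<gamma> - 1) * \<rho> (Suc k)" by (simp add: algebra_simps)
      moreover have "(\<gamma> - 1) * \<rho> 1 \<le> (\<gamma> - 1) * \<rho> (Suc k)"
        using ge[of "Suc k"] \<gamma> by (intro mult_left_mono) auto
      ultimately show False using N[of k] k by linarith
    qed
    have geo: "M (n + Suc N) \<le> \<tau> ^ n * M (Suc N)" for n
    proof (induction n)
      case (Suc n)
      have "M (Suc n + Suc N) \<le> \<tau> * M (n + Suc N)" using dec[of "n + Suc N"] by simp
      also have "\<dots> \<le> \<tau> * (\<tau> ^ n * M (Suc N))" using Suc \<tau> by (intro mult_left_mono) auto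
      finally show ?case by simp
    qed simp
    have "(\<lambda>n. \<tau> ^ n * M (Suc N)) \<longlonglongrightarrow> 0"
      using tendsto_mult_left_zero[OF LIMSEQ_realpow_zero[OF \<tau>]] by simp
    then have "(\<lambda>n. M (n + Suc N)) \<longlonglongrightarrow> 0"
      by (rule Lim_null_comparison[rotated]) (use geo M in auto)
    then have "M \<longlonglongrightarrow> 0" by (rule LIMSEQ_offset)
    moreover have "\<rho> k \<le> B" if "k \<ge> 1" for k using B[of "k - 1"] that by simp
    ultimately show ?thesis by blast
  qed
qed

text \<open>
  If \<open>\<rho>\<close> tends to infinity, \<open>\<rho> y\<close> eventually lies below \<open>- bmax\<close>. In the other case a positive value
  \<open>u k = b k + \<rho> k * y k\<close> would differ from \<open>b k\<close> by at least the fixed amount \<open>\<rho>min * \<bar>yl\<bar> / 2\<close>.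
\<close>

lemma inactive_multipliers_vanish:
  fixes \<rho> :: "nat \<Rightarrow> real"
  assumes y: "y \<longlonglongrightarrow> yl" "yl < 0"
    and \<rho>: "\<And>k. \<rho> k \<ge> \<rho>min" "\<rho>min > 0"
    and mbar: "\<And>k. b k \<le> bmax"
    and u: "\<And>k. u k = max 0 (b k + \<rho> k * y k)"
    and cases: "filterlim \<rho> at_top sequentially \<or> (\<lambda>k. u k - b k) \<longlonglongrightarrow> 0"
  shows "\<forall>\<^sub>F k in sequentially. u k = 0"
proof -
  have ev: "\<forall>\<^sub>F k in sequentially. y k < yl / 2"
    using y by (intro order_tendstoD) auto
  from cases show ?thesis
  proof
    assume "filterlim \<rho> at_top sequentially"
    then have "\<forall>\<^sub>F k in sequentially. \<rho> k \<ge> - 2 * bmax / yl" by (simp add: filterlim_at_top)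
    with ev show ?thesis
    proof eventually_elim
      case (elim k)
      have "\<rho> k * y k \<le> \<rho> k * (yl / 2)" using elim \<rho>(1)[of k] \<rho>(2) by (intro mult_left_mono) auto
      moreover have "\<rho> k * yl \<le> - 2 * bmax" using elim y(2) by (simp add: field_simps)
      ultimately show ?case using u[of k] mbar[of k] by simp
    qed
  next
    assume lim: "(\<lambda>k. u k - b k) \<longlonglongrightarrow> 0"
    have "\<rho>min * (yl / 2) < 0" using y(2) \<rho>(2) by (simp add: mult_pos_neg)
    then have "\<forall>\<^sub>F k in sequentially. u k - b k > \<rho>min * (yl / 2)"
      using lim by (intro order_tendstoD) auto
    with ev show ?thesis
    proof eventually_elim
      case (elim k)
      have "\<rho> k * y k \<le> \<rho>min * y k" using elim y(2) \<rho>(1)[of k] by (intro mult_right_mono_neg) auto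
      also have "\<dots> \<le> \<rho>min * (yl / 2)" using elim \<rho>(2) by (intro mult_left_mono) auto
      finally show ?case using u[of k] elim by (simp add: max_def split: if_splits)
    qed
  qed
qed

context riemannian_atlas
begin

lemma covector_of_has_derivative:
  assumes "((F \<circ> param \<phi>) has_derivative D) (at (coord \<phi> q))"
  shows "covector \<phi> F q = (\<Sum>b\<in>Basis. D b *\<^sub>R b)"
  unfolding covector_def frechet_derivative_at[OF assms, symmetric] ..

lemma aug_lagrangian_has_derivative:
  assumes \<rho>: "\<rho> > 0" and \<phi>: "\<phi> \<in> charts_at A q"
    and f: "differentiable_at_point f q"
    and h: "\<forall>i\<in>{1..s}. differentiable_at_point (h i) q"
    and g: "\<forall>j\<in>{1..m}. differentiable_at_point (g j) q"
  shows "(((\<lambda>q. aug_lagrangian s m f h g \<rho> q l u) \<circ> param \<phi>) has_derivative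
    (\<lambda>x. frechet_derivative (f \<circ> param \<phi>) (at (coord \<phi> q)) x +
      ((\<Sum>i=1..s. (l i + \<rho> * h i q) * frechet_derivative (h i \<circ> param \<phi>) (at (coord \<phi> q)) x) +
       (\<Sum>j=1..m. max 0 (u j + \<rho> * g j q) * frechet_derivative (g j \<circ> param \<phi>) (at (coord \<phi> q)) x))))
    (at (coord \<phi> q))"
proof -
  let ?z = "coord \<phi> q"
  have q: "param \<phi> ?z = q" using \<phi> by (simp add: charts_at_def param_coord)
  have D: "((\<lambda>z. F (param \<phi> z)) has_derivative frechet_derivative (F \<circ> param \<phi>) (at ?z)) (at ?z)"
    if "differentiable_at_point F q" for F
    using that \<phi> unfolding differentiable_at_point_def by (simp add: frechet_derivative_works o_def)
  have square: "((\<lambda>z. (h i (param \<phi> z) + l i / \<rho>)\<^sup>2) has_derivative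
      (\<lambda>x. frechet_derivative (h i \<circ> param \<phi>) (at ?z) x * (2 * (h i q + l i / \<rho>)))) (at ?z)"
    if i: "i \<in> {1..s}" for i
  proof (rule DERIV_compose_FDERIV[where f = "\<lambda>y. y\<^sup>2" and g = "\<lambda>z. h i (param \<phi> z) + l i / \<rho>"])
    show "((\<lambda>y::real. y\<^sup>2) has_real_derivative 2 * (h i q + l i / \<rho>)) (at (h i (param \<phi> ?z) + l i / \<rho>))"
      unfolding q by (auto intro!: derivative_eq_intros)
    show "((\<lambda>z. h i (param \<phi> z) + l i / \<rho>) has_derivative frechet_derivative (h i \<circ> param \<phi>) (at ?z)) (at ?z)"
      using D[OF bspec[OF h i]] by (rule has_derivative_add_const)
  qed
  have pos_part: "((\<lambda>z. (max 0 (g j (param \<phi> z) + u j / \<rho>))\<^sup>2) has_derivative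
      (\<lambda>x. frechet_derivative (g j \<circ> param \<phi>) (at ?z) x * (2 * max 0 (g j q + u j / \<rho>)))) (at ?z)"
    if j: "j \<in> {1..m}" for j
  proof (rule DERIV_compose_FDERIV[where f = "\<lambda>y. (max 0 y)\<^sup>2" and g = "\<lambda>z. g j (param \<phi> z) + u j / \<rho>"])
    show "((\<lambda>y::real. (max 0 y)\<^sup>2) has_real_derivative 2 * max 0 (g j q + u j / \<rho>))
        (at (g j (param \<phi> ?z) + u j / \<rho>))"
      unfolding q by (rule pos_part_square_has_derivative)
    show "((\<lambda>z. g j (param \<phi> z) + u j / \<rho>) has_derivative frechet_derivative (g j \<circ> param \<phi>) (at ?z)) (at ?z)"
      using D[OF bspec[OF g j]] by (rule has_derivative_add_const)
  qed
  have L: "(\<lambda>q. aug_lagrangian s m f h g \<rho> q l u) \<circ> param \<phi> = (\<lambda>z. f (param \<phi> z) + \<rho> / 2 *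
      ((\<Sum>i=1..s. (h i (param \<phi> z) + l i / \<rho>)\<^sup>2) + (\<Sum>j=1..m. (max 0 (g j (param \<phi> z) + u j / \<rho>))\<^sup>2)))"
    by (auto simp: fun_eq_iff aug_lagrangian_def L2_set_def sum_nonneg)
  have "((\<lambda>q. aug_lagrangian s m f h g \<rho> q l u) \<circ> param \<phi> has_derivative
    (\<lambda>x. frechet_derivative (f \<circ> param \<phi>) (at ?z) x + \<rho> / 2 *
      ((\<Sum>i=1..s. frechet_derivative (h i \<circ> param \<phi>) (at ?z) x * (2 * (h i q + l i / \<rho>))) +
       (\<Sum>j=1..m. frechet_derivative (g j \<circ> param \<phi>) (at ?z) x * (2 * max 0 (g j q + u j / \<rho>))))))
    (at ?z)"
    unfolding L
    by (intro has_derivative_add D[OF f] has_derivative_mult_right has_derivative_sum square pos_part)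
  moreover have "\<rho> / 2 * (d * (2 * (h i q + l i / \<rho>))) = (l i + \<rho> * h i q) * d" for i d
    using \<rho> by (simp add: field_simps)
  moreover have "\<rho> / 2 * (d * (2 * max 0 (g j q + u j / \<rho>))) = max 0 (u j + \<rho> * g j q) * d" for j d
  proof -
    have "\<rho> * max 0 (g j q + u j / \<rho>) = max (\<rho> * 0) (\<rho> * (g j q + u j / \<rho>))"
      using \<rho> by (simp add: max_mult_distrib_left)
    also have "\<dots> = max 0 (u j + \<rho> * g j q)" using \<rho> by (simp add: distrib_left add.commute)
    finally show ?thesis by simp
  qed
  ultimately show ?thesis by (simp only: distrib_left[of "\<rho> / 2"] sum_distrib_left)
qed

lemma differentiable_aug_lagrangian:
  assumes "\<rho> > 0" "differentiable_at_point f q"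
    and "\<forall>i\<in>{1..s}. differentiable_at_point (h i) q"
    and "\<forall>j\<in>{1..m}. differentiable_at_point (g j) q"
  shows "differentiable_at_point (\<lambda>q. aug_lagrangian s m f h g \<rho> q l u) q"
  unfolding differentiable_at_point_def
proof
  fix \<psi> assume "\<psi> \<in> charts_at A q"
  from aug_lagrangian_has_derivative[OF assms(1) this assms(2-)]
  show "((\<lambda>q. aug_lagrangian s m f h g \<rho> q l u) \<circ> param \<psi>) differentiable (at (coord \<psi> q))"
    unfolding differentiable_def by blast
qed

text \<open>
  The coefficients on the right are the updated multipliers; this is where the update formula of the
  algorithm comes from.
\<close>

lemma covector_aug_lagrangian:
  assumes "\<rho> > 0" "\<phi> \<in> charts_at A q" "differentiable_at_point f q"
    and "\<forall>i\<in>{1..s}. differentiable_at_point (h i) q"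
    and "\<forall>j\<in>{1..m}. differentiable_at_point (g j) q"
  shows "covector \<phi> (\<lambda>q. aug_lagrangian s m f h g \<rho> q l u) q = covector \<phi> f q +
    ((\<Sum>i=1..s. (l i + \<rho> * h i q) *\<^sub>R covector \<phi> (h i) q) +
     (\<Sum>j=1..m. max 0 (u j + \<rho> * g j q) *\<^sub>R covector \<phi> (g j) q))"
proof -
  have swap: "(\<Sum>i\<in>I. c i *\<^sub>R covector \<phi> (F i) q) =
      (\<Sum>b\<in>Basis. (\<Sum>i\<in>I. c i * frechet_derivative (F i \<circ> param \<phi>) (at (coord \<phi> q)) b) *\<^sub>R b)"
    for I and c :: "nat \<Rightarrow> real" and F :: "nat \<Rightarrow> 'a \<Rightarrow> real"
    unfolding covector_def scaleR_sum_right scaleR_sum_left scaleR_scaleR by (rule sum.swap)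
  show ?thesis
    unfolding covector_of_has_derivative[OF aug_lagrangian_has_derivative[OF assms]] swap
    by (simp only: covector_def scaleR_add_left sum.distrib)
qed

text \<open>
  Stationarity of the augmented Lagrangians at the iterates, read with the updated multipliers. The
  index is shifted to stay in the range where the algorithm runs and where all multipliers of
  inactive constraints have vanished.
\<close>

lemma approximate_KKT_sequence:
  assumes f: "C1_map A f" and h: "\<forall>i\<in>{1..s}. C1_map A (h i)" and g: "\<forall>j\<in>{1..m}. C1_map A (g j)"
    and al: "al_sequence A G s m f h g pk" and lim: "is_limit_point pk p"
    and feas: "p \<in> feasible_set s m h g" and \<phi>: "\<phi> \<in> charts_at A p"
  shows "\<exists>x l u. x \<longlonglongrightarrow> p \<and> (\<forall>k. \<forall>j\<in>{1..m}. u k j \<ge> 0) \<and>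
    (\<forall>k. \<forall>j\<in>{1..m} - active m g p. u k j = 0) \<and>
    (\<lambda>k. covector \<phi> f (x k) + ((\<Sum>i=1..s. l k i *\<^sub>R covector \<phi> (h i) (x k)) +
      (\<Sum>j=1..m. u k j *\<^sub>R covector \<phi> (g j) (x k)))) \<longlonglongrightarrow> 0"
proof -
  from al obtain \<tau> \<gamma> lmin lmax mmax :: real and \<epsilon> \<rho> :: "nat \<Rightarrow> real"
    and lbar mbar lam mu V :: "nat \<Rightarrow> nat \<Rightarrow> real" where H:
    "0 \<le> \<tau>" "\<tau> < 1" "\<gamma> > 1" "\<rho> 1 > 0" "\<epsilon> \<longlonglongrightarrow> 0"
    and H': "\<forall>k\<ge>1.
        (\<forall>i\<in>{1..s}. lbar k i \<in> {lmin..lmax}) \<and>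
        (\<forall>j\<in>{1..m}. mbar k j \<in> {0..mmax}) \<and>
        tnorm G (pk k)
          (grad A G (\<lambda>q. aug_lagrangian s m f h g (\<rho> k) q (lbar k) (mbar k)) (pk k)) \<le> \<epsilon> k \<and>
        (\<forall>i\<in>{1..s}. lam k i = lbar k i + \<rho> k * h i (pk k)) \<and>
        (\<forall>j\<in>{1..m}. mu k j = max 0 (mbar k j + \<rho> k * g j (pk k))) \<and>
        (\<forall>j\<in>{1..m}. V k j = (mu k j - mbar k j) / \<rho> k) \<and>
        \<rho> (k + 1) =
          (if k = 1 \<or>
              max (L2_set (\<lambda>i. h i (pk k)) {1..s}) (L2_set (V k) {1..m})
              \<le> \<tau> * max (L2_set (\<lambda>i. h i (pk (k - 1))) {1..s}) (L2_set (V (k - 1)) {1..m})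
           then \<rho> k else \<gamma> * \<rho> k)"
    unfolding al_sequence_def by (elim exE conjE) (rule that)
  define M where "M k = max (L2_set (\<lambda>i. h i (pk k)) {1..s}) (L2_set (V k) {1..m})" for k
  have M0: "M k \<ge> 0" for k unfolding M_def by (simp add: le_max_iff_disj L2_set_nonneg)
  have update: "\<forall>k\<ge>1. \<rho> (k + 1) = (if k = 1 \<or> M k \<le> \<tau> * M (k - 1) then \<rho> k else \<gamma> * \<rho> k)"
    using H' unfolding M_def by blast
  note penalty = penalty_dichotomy[OF H(4,3,1,2) M0 update]
  obtain r0 where r0: "strict_mono r0" "(pk \<circ> r0) \<longlonglongrightarrow> p" using lim unfolding is_limit_point_def by blast
  \<comment> \<open>The shift avoids the index \<open>0\<close>, at which the algorithm has not started.\<close>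
  define r where "r k = r0 (Suc k)" for k
  have r: "strict_mono r" using r0(1) by (simp add: r_def strict_mono_def)
  have r1: "r k \<ge> 1" for k using seq_suble[OF r0(1), of "Suc k"] by (simp add: r_def)
  define x where "x k = pk (r k)" for k
  have x: "x \<longlonglongrightarrow> p" using LIMSEQ_Suc[OF r0(2)] by (simp add: x_def[abs_def] r_def o_def)
  have \<rho>: "\<rho> (r k) \<ge> \<rho> 1" for k using penalty(1)[OF r1] .
  have \<rho>0: "\<rho> (r k) > 0" for k using \<rho>[of k] H(4) by linarith
  define u where "u k j = max 0 (mbar (r k) j + \<rho> (r k) * g j (x k))" for k j
  define l where "l k i = lbar (r k) i + \<rho> (r k) * h i (x k)" for k i
  let ?L = "\<lambda>k q. aug_lagrangian s m f h g (\<rho> (r k)) q (lbar (r k)) (mbar (r k))"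
  have diff: "differentiable_at_point f q" "\<forall>i\<in>{1..s}. differentiable_at_point (h i) q"
    "\<forall>j\<in>{1..m}. differentiable_at_point (g j) q" for q
    using f h g C1_map_differentiable by blast+
  have "(\<lambda>k. covector \<phi> (?L k) (x k)) \<longlonglongrightarrow> 0"
  proof (rule covector_vanishes[OF \<phi> x])
    show "differentiable_at_point (?L k) (x k)" for k
      by (rule differentiable_aug_lagrangian[OF \<rho>0 diff])
    show "tnorm G (x k) (grad A G (?L k) (x k)) \<le> (\<epsilon> \<circ> r) k" for k
      using H' r1[of k] unfolding x_def o_def by blast
    show "(\<epsilon> \<circ> r) \<longlonglongrightarrow> 0" by (rule LIMSEQ_subseq_LIMSEQ[OF H(5) r])
  qed
  moreover have "\<forall>\<^sub>F k in sequentially. covector \<phi> (?L k) (x k) =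
      covector \<phi> f (x k) + ((\<Sum>i=1..s. l k i *\<^sub>R covector \<phi> (h i) (x k)) +
      (\<Sum>j=1..m. u k j *\<^sub>R covector \<phi> (g j) (x k)))"
    using eventually_in_chart[OF \<phi> x]
    by eventually_elim (simp only: covector_aug_lagrangian[OF \<rho>0 _ diff] l_def u_def)
  ultimately have akkt: "(\<lambda>k. covector \<phi> f (x k) + ((\<Sum>i=1..s. l k i *\<^sub>R covector \<phi> (h i) (x k)) +
      (\<Sum>j=1..m. u k j *\<^sub>R covector \<phi> (g j) (x k)))) \<longlonglongrightarrow> 0"
    by (rule Lim_transform_eventually)
  have vanish: "\<forall>\<^sub>F k in sequentially. u k j = 0" if j: "j \<in> {1..m} - active m g p" for j
  proof (rule inactive_multipliers_vanish[where y = "\<lambda>k. g j (x k)" and yl = "g j p"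
        and \<rho> = "\<lambda>k. \<rho> (r k)" and \<rho>min = "\<rho> 1" and b = "\<lambda>k. mbar (r k) j" and bmax = mmax])
    show "(\<lambda>k. g j (x k)) \<longlonglongrightarrow> g j p" by (rule C1_map_tendsto[OF x]) (use g j in auto)
    show "g j p < 0" using feas j by (auto simp: feasible_set_def active_def order_less_le)
    show "mbar (r k) j \<le> mmax" for k using H' r1[of k] j by auto
    from penalty(2)
    show "filterlim (\<lambda>k. \<rho> (r k)) at_top sequentially \<or> (\<lambda>k. u k j - mbar (r k) j) \<longlonglongrightarrow> 0"
    proof
      assume "filterlim \<rho> at_top sequentially"
      then show ?thesis using filterlim_compose[OF _ filterlim_subseq[OF r]] by blast
    next
      assume "\<exists>B. (\<forall>k\<ge>1. \<rho> k \<le> B) \<and> M \<longlonglongrightarrow> 0"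
      then obtain B where B: "\<And>k. k \<ge> 1 \<Longrightarrow> \<rho> k \<le> B" and M: "M \<longlonglongrightarrow> 0" by blast
      have "(\<lambda>k. u k j - mbar (r k) j) \<longlonglongrightarrow> 0"
      proof (rule Lim_null_comparison)
        have "norm (u k j - mbar (r k) j) \<le> B * M (r k)" for k
        proof -
          have V: "V (r k) j = (u k j - mbar (r k) j) / \<rho> (r k)"
            using H' r1[of k] j unfolding u_def x_def by auto
          then have "u k j - mbar (r k) j = \<rho> (r k) * V (r k) j" using \<rho>0[of k] by simp
          moreover have "\<bar>V (r k) j\<bar> \<le> M (r k)"
            using abs_le_L2_set[of "{1..m}" j "V (r k)"] j by (simp add: M_def le_max_iff_disj)
          ultimately show ?thesis
            using B[OF r1, of k] \<rho>0[of k] M0[of "r k"] by (simp add: abs_mult mult_mono)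
        qed
        then show "\<forall>\<^sub>F k in sequentially. norm (u k j - mbar (r k) j) \<le> B * M (r k)" by simp
        show "(\<lambda>k. B * M (r k)) \<longlonglongrightarrow> 0"
          using tendsto_mult_right_zero[OF LIMSEQ_subseq_LIMSEQ[OF M r], of B] by (simp add: o_def)
      qed
      then show ?thesis ..
    qed
  qed (use \<rho> H(4) in \<open>auto simp: u_def\<close>)
  have "\<forall>\<^sub>F k in sequentially. \<forall>j\<in>{1..m} - active m g p. u k j = 0"
    using vanish by (simp add: eventually_ball_finite)
  then obtain N where N: "\<And>k. k \<ge> N \<Longrightarrow> \<forall>j\<in>{1..m} - active m g p. u k j = 0"
    unfolding eventually_sequentially by blast
  show ?thesis
    using LIMSEQ_ignore_initial_segment[OF x, of N] LIMSEQ_ignore_initial_segment[OF akkt, of N] N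
    by (intro exI[of _ "\<lambda>k. x (k + N)"] exI[of _ "\<lambda>k. l (k + N)"] exI[of _ "\<lambda>k. u (k + N)"])
      (auto simp: u_def)
qed

end

section \<open>From approximate stationarity to the KKT conditions\<close>

lemma sum_Inl_Inr:
  assumes "finite I" "finite J"
  shows "(\<Sum>x\<in>Inl ` I \<union> Inr ` J. F x) = (\<Sum>i\<in>I. F (Inl i)) + (\<Sum>j\<in>J. F (Inr j))"
proof -
  have "(\<Sum>x\<in>Inl ` I \<union> Inr ` J. F x) = (\<Sum>x\<in>Inl ` I. F x) + (\<Sum>x\<in>Inr ` J. F x)"
    using assms by (intro sum.union_disjoint) auto
  then show ?thesis by (simp add: sum.reindex)
qed

lemma lin_dependent_iff:
  assumes "finite I" "finite J"
  shows "lin_dependent I v J w \<longleftrightarrow> \<not> indep_family (Inl ` I \<union> Inr ` J) (case_sum v w)"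
proof
  assume "lin_dependent I v J w"
  then obtain \<alpha> \<beta> where "(\<exists>i\<in>I. \<alpha> i \<noteq> 0) \<or> (\<exists>j\<in>J. \<beta> j \<noteq> 0)"
     "(\<Sum>i\<in>I. \<alpha> i *\<^sub>R v i) + (\<Sum>j\<in>J. \<beta> j *\<^sub>R w j) = 0"
    unfolding lin_dependent_def by blast
  then have "(\<Sum>x\<in>Inl ` I \<union> Inr ` J. case_sum \<alpha> \<beta> x *\<^sub>R case_sum v w x) = 0"
    "\<exists>x\<in>Inl ` I \<union> Inr ` J. case_sum \<alpha> \<beta> x \<noteq> 0"
    unfolding sum_Inl_Inr[OF assms] by force+
  then show "\<not> indep_family (Inl ` I \<union> Inr ` J) (case_sum v w)"
    unfolding indep_family_def by blast
next
  assume "\<not> indep_family (Inl ` I \<union> Inr ` J) (case_sum v w)"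
  then obtain a where "(\<Sum>i\<in>I. a (Inl i) *\<^sub>R v i) + (\<Sum>j\<in>J. a (Inr j) *\<^sub>R w j) = 0"
     "\<exists>x\<in>Inl ` I \<union> Inr ` J. a x \<noteq> 0"
    unfolding indep_family_def sum_Inl_Inr[OF assms] by auto
  then show "lin_dependent I v J w"
    unfolding lin_dependent_def by (intro exI[of _ "a \<circ> Inl"] exI[of _ "a \<circ> Inr"]) auto
qed

context riemannian_atlas
begin

text \<open>
  The families over equality and inequality constraints are joined over a sum type, and the
  hypotheses on gradients are carried to covectors by the injective linear maps of
  \<open>gradient_from_covector\<close>, a different one at each point.
\<close>

lemma approximate_KKT_imp_KKT:
  assumes f: "C1_map A f" and h: "\<forall>i\<in>{1..s}. C1_map A (h i)" and g: "\<forall>j\<in>{1..m}. C1_map A (g j)"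
    and \<phi>: "\<phi> \<in> charts_at A p" and x: "x \<longlonglongrightarrow> p"
    and u: "\<forall>k. \<forall>j\<in>{1..m}. u k j \<ge> 0" "\<forall>k. \<forall>j\<in>{1..m} - active m g p. u k j = 0"
    and lim: "(\<lambda>k. covector \<phi> f (x k) + ((\<Sum>i=1..s. l k i *\<^sub>R covector \<phi> (h i) (x k)) +
      (\<Sum>j=1..m. u k j *\<^sub>R covector \<phi> (g j) (x k)))) \<longlonglongrightarrow> 0"
    and cq: "RCPLD A G s m h g p \<or> CRSC A G s m h g p"
  shows "KKT A G s m f h g p"
proof -
  define Act where "Act = active m g p"
  have Act: "Act \<subseteq> {1..m}" "finite Act" by (auto simp: Act_def active_def)
  define F P where "F = (Inl ` {1..s} :: (nat + nat) set)" and "P = (Inr ` Act :: (nat + nat) set)"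
  have FP: "finite F" "finite P" "F \<inter> P = {}" using Act by (auto simp: F_def P_def)
  define cv where "cv q = case_sum (\<lambda>i. covector \<phi> (h i) q) (\<lambda>j. covector \<phi> (g j) q)" for q
  define gv where "gv q = case_sum (\<lambda>i. grad A G (h i) q) (\<lambda>j. grad A G (g j) q)" for q
  let ?w = "- covector \<phi> f p"
  define C where "C = {\<Sum>i\<in>F \<union> P. c i *\<^sub>R cv p i | c. \<forall>i\<in>P. c i \<ge> 0}"
  have sharp: "\<exists>S. linear S \<and> inj S \<and> grad A G f q = S (covector \<phi> f q) \<and>
      (\<forall>i\<in>F \<union> P. gv q i = S (cv q i))" if q: "\<phi> \<in> charts_at A q" for q
  proof -
    obtain S where S: "linear S" "inj S"
        "\<And>E. differentiable_at_point E q \<Longrightarrow> grad A G E q = S (covector \<phi> E q)"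
      using gradient_from_covector[OF q] by blast
    then have "\<forall>i\<in>F \<union> P. gv q i = S (cv q i)"
      using h g Act(1) C1_map_differentiable by (auto simp: F_def P_def gv_def cv_def)
    then show ?thesis using S f C1_map_differentiable by blast
  qed
  obtain S where S: "linear S" "inj S" "grad A G f p = S (covector \<phi> f p)"
      "\<And>i. i \<in> F \<union> P \<Longrightarrow> gv p i = S (cv p i)"
    using sharp[OF \<phi>] by blast
  have S_sum: "(\<Sum>i\<in>I. c i *\<^sub>R gv p i) = S (\<Sum>i\<in>I. c i *\<^sub>R cv p i)" if "I \<subseteq> F \<union> P" for I c
    using that S(4) by (simp add: linear_sum[OF S(1)] linear_scale[OF S(1)] subset_iff)
  have S_inj: "S y = S z \<longleftrightarrow> y = z" for y z using S(2) by (auto dest: injD)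
  have sum_gv: "(\<Sum>i=1..s. c (Inl i) *\<^sub>R grad A G (h i) p) + (\<Sum>j\<in>Act. c (Inr j) *\<^sub>R grad A G (g j) p)
      = S (\<Sum>i\<in>F \<union> P. c i *\<^sub>R cv p i)" for c
    using S_sum[of "F \<union> P" c] Act(2) by (simp add: F_def P_def sum_Inl_Inr gv_def)
  have KKT_from_cone: "KKT A G s m f h g p" if "?w \<in> C"
  proof -
    from that obtain c where c: "?w = (\<Sum>i\<in>F \<union> P. c i *\<^sub>R cv p i)" "\<forall>i\<in>P. c i \<ge> 0"
      unfolding C_def by blast
    define mu where "mu j = (if j \<in> Act then c (Inr j) else 0)" for j
    have "(\<Sum>j=1..m. mu j *\<^sub>R grad A G (g j) p) = (\<Sum>j\<in>Act. mu j *\<^sub>R grad A G (g j) p)"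
      by (rule sum.mono_neutral_right) (use Act in \<open>auto simp: mu_def\<close>)
    also have "\<dots> = (\<Sum>j\<in>Act. c (Inr j) *\<^sub>R grad A G (g j) p)" by (simp add: mu_def)
    finally have "(\<Sum>i=1..s. c (Inl i) *\<^sub>R grad A G (h i) p) + (\<Sum>j=1..m. mu j *\<^sub>R grad A G (g j) p) = S ?w"
      using sum_gv[of c] c(1) by simp
    then have "grad A G f p + (\<Sum>i=1..s. c (Inl i) *\<^sub>R grad A G (h i) p) +
        (\<Sum>j=1..m. mu j *\<^sub>R grad A G (g j) p) = 0"
      using S(3) by (simp add: linear_neg[OF S(1)] add.assoc)
    moreover have "\<forall>j\<in>{1..m}. mu j \<ge> 0" using c(2) by (auto simp: mu_def P_def)
    moreover have "\<forall>j\<in>{1..m} - active m g p. mu j = 0" by (simp add: mu_def Act_def)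
    ultimately show ?thesis
      unfolding KKT_def by (intro exI[of _ "\<lambda>i. c (Inl i)"] exI[of _ mu] conjI)
  qed
  define a where "a k = case_sum (l k) (u k)" for k
  have a_nonneg: "a k i \<ge> 0" if "i \<in> P" for k i
    using that u(1) Act(1) by (auto simp: a_def P_def)
  have cv_lim: "(\<lambda>k. cv (x k) i) \<longlonglongrightarrow> cv p i" if "i \<in> F \<union> P" for i
  proof (cases i)
    case (Inl j)
    then have "C1_map A (h j)" using that h by (auto simp: F_def P_def)
    then show ?thesis unfolding cv_def Inl sum.case by (rule covector_tendsto[OF \<phi> x])
  next
    case (Inr j)
    then have "C1_map A (g j)" using that g Act(1) by (auto simp: F_def P_def)
    then show ?thesis unfolding cv_def Inr sum.case by (rule covector_tendsto[OF \<phi> x])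
  qed
  have a_lim: "(\<lambda>k. \<Sum>i\<in>F \<union> P. a k i *\<^sub>R cv (x k) i) \<longlonglongrightarrow> ?w"
  proof -
    have "(\<Sum>j=1..m. u k j *\<^sub>R covector \<phi> (g j) (x k)) = (\<Sum>j\<in>Act. u k j *\<^sub>R covector \<phi> (g j) (x k))" for k
      by (rule sum.mono_neutral_right) (use Act u(2) in \<open>auto simp: Act_def\<close>)
    then have "(\<Sum>i\<in>F \<union> P. a k i *\<^sub>R cv (x k) i) = (covector \<phi> f (x k) +
        ((\<Sum>i=1..s. l k i *\<^sub>R covector \<phi> (h i) (x k)) +
         (\<Sum>j=1..m. u k j *\<^sub>R covector \<phi> (g j) (x k)))) - covector \<phi> f (x k)" for k
      using Act(2) by (simp add: F_def P_def sum_Inl_Inr a_def cv_def)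
    then show ?thesis using tendsto_diff[OF lim covector_tendsto[OF \<phi> x f]] by simp
  qed
  have tail: "\<exists>N. \<forall>k\<ge>N. \<phi> \<in> charts_at A (x k) \<and> x k \<in> riem_ball A G p \<epsilon>" and p_ball: "p \<in> riem_ball A G p \<epsilon>"
    if \<epsilon>: "\<epsilon> > 0" for \<epsilon>
  proof -
    obtain U where U: "open U" "p \<in> U" "U \<subseteq> riem_ball A G p \<epsilon>"
      using riem_ball_contains_neighbourhood[OF \<epsilon>] by blast
    then show "p \<in> riem_ball A G p \<epsilon>" by blast
    have "\<forall>\<^sub>F k in sequentially. \<phi> \<in> charts_at A (x k) \<and> x k \<in> riem_ball A G p \<epsilon>"
      using eventually_in_chart[OF \<phi> x] topological_tendstoD[OF x U(1,2)]
      by eventually_elim (use U(3) in blast)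
    then show "\<exists>N. \<forall>k\<ge>N. \<phi> \<in> charts_at A (x k) \<and> x k \<in> riem_ball A G p \<epsilon>"
      unfolding eventually_sequentially .
  qed
  have dim_gv: "dim (gv q ` I) = dim (cv q ` I)" if q: "\<phi> \<in> charts_at A q" and I: "I \<subseteq> F \<union> P" for q I
  proof -
    obtain R where R: "linear R" "inj R" "\<forall>i\<in>F \<union> P. gv q i = R (cv q i)" using sharp[OF q] by blast
    then have "gv q ` I = R ` (cv q ` I)" using I by (force simp: image_image)
    then show ?thesis using dim_linear_image[OF R(1,2)] by simp
  qed
  from cq show ?thesis
  proof
    assume "RCPLD A G s m h g p"
    then obtain \<epsilon> d K where \<epsilon>: "\<epsilon> > 0"
      and d: "\<forall>q\<in>riem_ball A G p \<epsilon>. dim ((\<lambda>i. grad A G (h i) q) ` {1..s}) = d"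
      and K: "basis_indices K {1..s} (\<lambda>i. grad A G (h i) p)"
      and pld: "\<forall>J\<subseteq>Act. pos_lin_dependent K (\<lambda>i. grad A G (h i) p) J (\<lambda>j. grad A G (g j) p) \<longrightarrow>
          (\<forall>q\<in>riem_ball A G p \<epsilon>. lin_dependent K (\<lambda>i. grad A G (h i) q) J (\<lambda>j. grad A G (g j) q))"
      unfolding RCPLD_def Act_def[symmetric] by (elim exE conjE) (rule that)
    obtain N where N: "\<And>k. k \<ge> N \<Longrightarrow> \<phi> \<in> charts_at A (x k) \<and> x k \<in> riem_ball A G p \<epsilon>"
      using tail[OF \<epsilon>] by blast
    have finK: "finite K" and Ksub: "K \<subseteq> {1..s}"
      using K finite_subset unfolding basis_indices_def by auto
    define K' where "K' = (Inl ` K :: (nat + nat) set)"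
    have K'F: "K' \<subseteq> F" "finite K'" using Ksub finK by (auto simp: K'_def F_def)
    have rank: "dim (cv q ` F) = d" if "q \<in> riem_ball A G p \<epsilon>" "\<phi> \<in> charts_at A q" for q
      using dim_gv[OF that(2), of F] d that(1) by (simp add: F_def gv_def image_image)
    have gvK: "inj_on (gv p) K'" "independent (gv p ` K')" "span (gv p ` K') = span (gv p ` F)"
      using K by (auto simp: basis_indices_def K'_def F_def gv_def image_image inj_on_def)
    have "indep_family K' (gv p)" using gvK indep_family_iff[OF K'F(2)] by blast
    then have "indep_family K' (\<lambda>i. S (cv p i))"
      using S(4) K'F(1) unfolding indep_family_def by (simp add: subset_iff)
    then have indepK: "indep_family K' (cv p)" using indep_family_linear_image[OF S(1,2)] by blast
    have "S ` span (cv p ` K') = S ` span (cv p ` F)"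
    proof -
      have "gv p ` I = S ` (cv p ` I)" if "I \<subseteq> F" for I
        using S(4) that by (force simp: image_image)
      then show ?thesis using gvK(3) K'F(1) by (simp add: linear_span_image[OF S(1), symmetric])
    qed
    then have spanK: "span (cv p ` K') = span (cv p ` F)" using S(2) by (simp add: inj_image_eq_iff)
    have "\<exists>c. (\<forall>i\<in>P. c i \<ge> 0) \<and> (\<Sum>i\<in>F \<union> P. c i *\<^sub>R cv p i) = ?w"
    proof (rule combination_limit_RCPLD[OF FP _ _ _ K'F(1) indepK spanK,
          where v = "\<lambda>k. cv (x (k + N))" and a = "\<lambda>k. a (k + N)"])
      show "(\<lambda>k. cv (x (k + N)) i) \<longlonglongrightarrow> cv p i" if "i \<in> F \<union> P" for i
        by (rule LIMSEQ_ignore_initial_segment[OF cv_lim[OF that]])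
      show "(\<lambda>k. \<Sum>i\<in>F \<union> P. a (k + N) i *\<^sub>R cv (x (k + N)) i) \<longlonglongrightarrow> ?w"
        by (rule LIMSEQ_ignore_initial_segment[OF a_lim])
      show "a (k + N) i \<ge> 0" if "i \<in> P" for k i by (rule a_nonneg[OF that])
      show "dim (cv (x (k + N)) ` F) = dim (cv p ` F)" for k
        using rank N[of "k + N"] p_ball[OF \<epsilon>] \<phi> by simp
      fix J' c k
      assume J': "J' \<subseteq> P" and c: "\<forall>i\<in>J'. (0::real) \<le> c i" "\<exists>i\<in>K' \<union> J'. c i \<noteq> 0"
        "(\<Sum>i\<in>K' \<union> J'. c i *\<^sub>R cv p i) = 0"
      define J where "J = Inr -` J'"
      have J: "J' = Inr ` J" "J \<subseteq> Act" using J' by (auto simp: J_def P_def)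
      have finJ: "finite J" using J(2) Act(2) finite_subset by blast
      have sub: "K' \<union> J' \<subseteq> F \<union> P" using K'F(1) J' by blast
      have "(\<Sum>i\<in>K. c (Inl i) *\<^sub>R grad A G (h i) p) + (\<Sum>j\<in>J. c (Inr j) *\<^sub>R grad A G (g j) p) = S 0"
        using S_sum[OF sub, of c] c(3) finK finJ by (simp add: K'_def J(1) sum_Inl_Inr gv_def)
      then have "pos_lin_dependent K (\<lambda>i. grad A G (h i) p) J (\<lambda>j. grad A G (g j) p)"
        unfolding pos_lin_dependent_def using c(1,2) linear_0[OF S(1)]
        by (intro exI[of _ "c \<circ> Inl"] exI[of _ "c \<circ> Inr"]) (auto simp: K'_def J(1))
      then have "lin_dependent K (\<lambda>i. grad A G (h i) (x (k + N))) J (\<lambda>j. grad A G (g j) (x (k + N)))"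
        using pld J(2) N[of "k + N"] by simp
      then have dep: "\<not> indep_family (K' \<union> J') (gv (x (k + N)))"
        unfolding lin_dependent_iff[OF finK finJ] by (simp add: K'_def J(1) gv_def)
      obtain R where R: "linear R" "inj R" "\<And>i. i \<in> F \<union> P \<Longrightarrow> gv (x (k + N)) i = R (cv (x (k + N)) i)"
        using sharp[of "x (k + N)"] N[of "k + N"] by auto
      have "indep_family (K' \<union> J') (gv (x (k + N))) \<longleftrightarrow>
          indep_family (K' \<union> J') (\<lambda>i. R (cv (x (k + N)) i))"
        by (rule indep_family_cong) (use R(3) sub in blast)
      with dep have "\<not> indep_family (K' \<union> J') (\<lambda>i. R (cv (x (k + N)) i))" by blast
      then show "\<not> indep_family (K' \<union> J') (cv (x (k + N)))"
        using indep_family_linear_image[OF R(1,2)] by blast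
    qed
    then obtain c where "\<forall>i\<in>P. c i \<ge> 0" "(\<Sum>i\<in>F \<union> P. c i *\<^sub>R cv p i) = ?w" by blast
    then have "?w \<in> C" unfolding C_def by (intro CollectI exI[of _ c]) simp
    then show ?thesis by (rule KKT_from_cone)
  next
    assume "CRSC A G s m h g p"
    then obtain \<epsilon> d where \<epsilon>: "\<epsilon> > 0"
      and d: "\<forall>q\<in>riem_ball A G p \<epsilon>. dim ((\<lambda>i. grad A G (h i) q) ` {1..s} \<union>
          (\<lambda>j. grad A G (g j) q) ` J_minus A G s m h g p) = d"
      unfolding CRSC_def by (elim exE conjE) (rule that)
    obtain N where N: "\<And>k. k \<ge> N \<Longrightarrow> \<phi> \<in> charts_at A (x k) \<and> x k \<in> riem_ball A G p \<epsilon>"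
      using tail[OF \<epsilon>] by blast
    have polar: "polar_cone A G s m h g p = S ` C"
    proof
      show "polar_cone A G s m h g p \<subseteq> S ` C"
      proof
        fix y assume "y \<in> polar_cone A G s m h g p"
        then obtain lam mu where y: "y = (\<Sum>i=1..s. lam i *\<^sub>R grad A G (h i) p) +
            (\<Sum>j\<in>Act. mu j *\<^sub>R grad A G (g j) p)" "\<forall>j\<in>Act. mu j \<ge> 0"
          unfolding polar_cone_def Act_def by blast
        then have "y = S (\<Sum>i\<in>F \<union> P. case_sum lam mu i *\<^sub>R cv p i)"
          using sum_gv[of "case_sum lam mu"] by simp
        moreover have "\<forall>i\<in>P. case_sum lam mu i \<ge> 0" using y(2) by (auto simp: P_def)
        ultimately show "y \<in> S ` C" unfolding C_def by blast
      qed
      show "S ` C \<subseteq> polar_cone A G s m h g p"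
      proof
        fix y assume "y \<in> S ` C"
        then obtain c where c: "y = S (\<Sum>i\<in>F \<union> P. c i *\<^sub>R cv p i)" "\<forall>i\<in>P. c i \<ge> 0"
          unfolding C_def by blast
        then have "\<forall>j\<in>Act. c (Inr j) \<ge> 0" by (auto simp: P_def)
        then show "y \<in> polar_cone A G s m h g p"
          unfolding polar_cone_def c(1) sum_gv[symmetric] Act_def
          by (intro CollectI exI[of _ "\<lambda>i. c (Inl i)"] exI[of _ "\<lambda>j. c (Inr j)"]) simp
      qed
    qed
    define M where "M = {i \<in> P. - cv p i \<in> C}"
    have M: "M = Inr ` J_minus A G s m h g p"
    proof -
      have "- grad A G (g j) p \<in> S ` C \<longleftrightarrow> - cv p (Inr j) \<in> C" if "j \<in> Act" for j
      proof -
        have "- grad A G (g j) p = S (- cv p (Inr j))"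
          using S(4)[of "Inr j"] that by (simp add: P_def gv_def linear_neg[OF S(1)])
        then show ?thesis using S_inj by auto
      qed
      then show ?thesis unfolding M_def J_minus_def polar P_def Act_def by auto
    qed
    have rank: "dim (cv q ` (F \<union> M)) = d" if "q \<in> riem_ball A G p \<epsilon>" "\<phi> \<in> charts_at A q" for q
    proof -
      have "F \<union> M \<subseteq> F \<union> P" by (auto simp: M_def)
      then show ?thesis
        using dim_gv[OF that(2), of "F \<union> M"] d that(1)
        by (simp add: M F_def gv_def image_image image_Un)
    qed
    have "?w \<in> C"
    proof (rule combination_limit_CRSC[OF FP _ _ _ C_def M_def,
          where v = "\<lambda>k. cv (x (k + N))" and a = "\<lambda>k. a (k + N)"])
      show "(\<lambda>k. cv (x (k + N)) i) \<longlonglongrightarrow> cv p i" if "i \<in> F \<union> P" for i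
        by (rule LIMSEQ_ignore_initial_segment[OF cv_lim[OF that]])
      show "(\<lambda>k. \<Sum>i\<in>F \<union> P. a (k + N) i *\<^sub>R cv (x (k + N)) i) \<longlonglongrightarrow> ?w"
        by (rule LIMSEQ_ignore_initial_segment[OF a_lim])
      show "a (k + N) i \<ge> 0" if "i \<in> P" for k i by (rule a_nonneg[OF that])
      show "dim (cv (x (k + N)) ` (F \<union> M)) = dim (cv p ` (F \<union> M))" for k
        using rank N[of "k + N"] p_ball[OF \<epsilon>] \<phi> by simp
    qed
    then show ?thesis by (rule KKT_from_cone)
  qed
qed

end

theorem corollary3p1:
  fixes A :: "('a::{second_countable_topology, t2_space}, 'e::euclidean_space) chart set"
    and G :: "('a, 'e) metric"
    and s m :: nat
    and f :: "'a \<Rightarrow> real"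
    and h g :: "nat \<Rightarrow> 'a \<Rightarrow> real"
    and pk :: "nat \<Rightarrow> 'a"
    and p :: 'a
  assumes "complete_riemannian_manifold A G"
    and "C1_map A f"
    and "\<forall>i\<in>{1..s}. C1_map A (h i)"
    and "\<forall>j\<in>{1..m}. C1_map A (g j)"
    and "al_sequence A G s m f h g pk"
    and "is_limit_point pk p"
    and "p \<in> feasible_set s m h g"
    and "RCPLD A G s m h g p \<or> CRSC A G s m h g p"
  shows "KKT A G s m f h g p"
proof -
  interpret riemannian_atlas A G
    using assms(1) unfolding complete_riemannian_manifold_def by unfold_locales auto
  obtain \<phi> where \<phi>: "\<phi> \<in> charts_at A p" using chart_at_exists by blast
  obtain x l u where "x \<longlonglongrightarrow> p" "\<forall>k. \<forall>j\<in>{1..m}. u k j \<ge> 0"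
    "\<forall>k. \<forall>j\<in>{1..m} - active m g p. u k j = 0"
    "(\<lambda>k. covector \<phi> f (x k) + ((\<Sum>i=1..s. l k i *\<^sub>R covector \<phi> (h i) (x k)) +
      (\<Sum>j=1..m. u k j *\<^sub>R covector \<phi> (g j) (x k)))) \<longlonglongrightarrow> 0"
    using approximate_KKT_sequence[OF assms(2-7) \<phi>] by blast
  then show ?thesis
    by (rule approximate_KKT_imp_KKT[OF assms(2-4) \<phi> _ _ _ _ assms(8)])
qed

end
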